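(* In the Kronecker quantum cluster algebra with principal coefficients $\mathcal{A}_q(Q)$, with cluster variables $x_l$ ($l\in\mathbb{Z}$) and elements $F_m$ (modified Chebyshev polynomials of the first kind evaluated at $X_\delta$), the following hold for integers $m,n$: (1) $$F_m x_{-n}=\begin{cases} x_{-(n+m)} + X^{(0,0,m,m)} x_{-(n-m)} & \text{for } 1\leq m\leq n;\\ x_{-(n+m)} + q^{-\frac{2m-1}{2}}X^{(0,0,n,n+1)} x_{m-n}& \text{for } n\geq 0,\ n+1\leq m.\end{cases}$$ (2) $$x_n F_m=\begin{cases} x_{n+m} + x_{n-m} X^{(0,0,m,m)} & \text{for } 1\leq m< n;\\ x_{n+m} + q^{-\frac{2m-1}{2}} x_{-(m-n)} X^{(0,0,n,n-1)}& \text{for } 1\leq n\leq m.\end{cases}$$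
   Context: Let $k=\mathbb{F}_q$ be a finite field with $q$ elements. Let $\Lambda$ be the skew-symmetric bilinear form on $\mathbb{Z}^4$ (natural basis $e_1,\dots,e_4$) with $\Lambda(e_1,e_3)=-1$, $\Lambda(e_2,e_4)=-1$, $\Lambda(e_3,e_4)=-2$, $\Lambda(e_1,e_2)=\Lambda(e_1,e_4)=\Lambda(e_2,e_3)=0$. The quantum torus is the $\mathbb{Z}[q^{\pm 1/2}]$-algebra with basis $\{X^{e}: e\in\mathbb{Z}^4\}$ and product $X^{e}X^{f}=q^{\Lambda(e,f)/2}X^{e+f}$. All identities are in this algebra. Put $y_1=X^{(0,0,1,0)}$, $y_2=X^{(0,0,0,1)}$ (the coefficients). Let $Q$ be the Kronecker quiver with two vertices $1,2$ and two arrows $1\to 2$. For $l\ge 0$ let $V(-l)$ be the indecomposable preprojective $kQ$-module with dimension vector $(l,l+1)$ and $V(l+3)$ the indecomposable preinjective $kQ$-module with dimension vector $(l+1,l)$. For a $kQ$-module $M$ with dimension vector $m=(m_1,m_2)$, the quantum cluster character is $$X_M=\sum_{e=(e_1,e_2)}|\mathrm{Gr}_e M|\,q^{-\frac12\langle e,m-e\rangle}X^{(2m_2-m_1-2e_2,\;2e_1-m_2,\;m_1-e_1,\;m_2-e_2)},$$ where $\mathrm{Gr}_eM$ is the set of submodules of $M$ of dimension vector $e$ and $\langle a,b\rangle=a_1b_1+a_2b_2-2a_1b_2$ is the Euler form. The cluster variables are $x_1=X^{(1,0,0,0)}$, $x_2=X^{(0,1,0,0)}$ and $x_l=X_{V(l)}$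 for $l\in\mathbb{Z}\setminus\{1,2\}$. The algebra $\mathcal{A}_q(Q)$ is the subalgebra of the quantum torus generated over $\mathbb{Z}[q^{\pm1/2}][y_1^{\pm1},y_2^{\pm1}]$ by all $x_l$, $l\in\mathbb{Z}$. Let $X_\delta=X^{(1,-1,1,1)}+X^{(-1,-1,1,0)}+X^{(-1,1,0,0)}$. Define $F_0=1$, $F_1=X_\delta$, $F_2=F_1F_1-2X^{(0,0,1,1)}$, and $F_{n+1}=F_nF_1-X^{(0,0,1,1)}F_{n-1}$ for $n\ge 2$. *)

theory Defs
  imports
    Complex_Main
    "HOL-Library.Cardinality"
    "HOL-Library.Function_Algebras"
    "HOL-Library.Product_Plus"
begin

section \<open>The coefficient ring\<close>

text \<open>The finite field is the type \<open>'k\<close>, so \<open>q\<close> is \<open>CARD('k)\<close>, and \<open>q\<^sup>1\<^sup>/\<^sup>2\<close> is the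
  positive real square root of \<open>q\<close>.\<close>

inductive_set adjoin_unit :: "real \<Rightarrow> real set" for s :: real where
  one: "1 \<in> adjoin_unit s"
| gen: "s \<in> adjoin_unit s"
| inv: "inverse s \<in> adjoin_unit s"
| diff: "a \<in> adjoin_unit s \<Longrightarrow> b \<in> adjoin_unit s \<Longrightarrow> a - b \<in> adjoin_unit s"
| mult: "a \<in> adjoin_unit s \<Longrightarrow> b \<in> adjoin_unit s \<Longrightarrow> a * b \<in> adjoin_unit s"

lemma adjoin_unit_zero: "0 \<in> adjoin_unit s"
  using adjoin_unit.diff[OF adjoin_unit.one adjoin_unit.one] by simp

lemma adjoin_unit_uminus: "a \<in> adjoin_unit s \<Longrightarrow> - a \<in> adjoin_unit s"
  using adjoin_unit.diff[OF adjoin_unit_zero] by fastforce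

lemma adjoin_unit_add: "a \<in> adjoin_unit s \<Longrightarrow> b \<in> adjoin_unit s \<Longrightarrow> a + b \<in> adjoin_unit s"
  using adjoin_unit.diff[OF _ adjoin_unit_uminus] by fastforce

lemma adjoin_unit_powi: "s powi n \<in> adjoin_unit s"
proof -
  have pow: "x ^ k \<in> adjoin_unit s" if "x \<in> adjoin_unit s" for x k
    by (induction k) (auto intro: adjoin_unit.one adjoin_unit.mult that)
  show ?thesis
    unfolding power_int_def by (auto intro: pow adjoin_unit.gen adjoin_unit.inv)
qed

text \<open>The ring \<open>\<int>[q\<^sup>\<plusminus>\<^sup>1\<^sup>/\<^sup>2]\<close>; it depends on \<open>'k\<close> through \<open>q\<close> only.\<close>

typedef (overloaded) 'k qcoeff = "adjoin_unit (sqrt (real CARD('k::{field,finite})))"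
  by (rule exI, rule adjoin_unit.one)

setup_lifting type_definition_qcoeff

instantiation qcoeff :: ("{field,finite}") comm_ring_1
begin

lift_definition zero_qcoeff :: "'a qcoeff" is 0 by (rule adjoin_unit_zero)
lift_definition one_qcoeff :: "'a qcoeff" is 1 by (rule adjoin_unit.one)
lift_definition plus_qcoeff :: "'a qcoeff \<Rightarrow> 'a qcoeff \<Rightarrow> 'a qcoeff" is "(+)"
  by (rule adjoin_unit_add)
lift_definition minus_qcoeff :: "'a qcoeff \<Rightarrow> 'a qcoeff \<Rightarrow> 'a qcoeff" is "(-)"
  by (rule adjoin_unit.diff)
lift_definition uminus_qcoeff :: "'a qcoeff \<Rightarrow> 'a qcoeff" is uminus
  by (rule adjoin_unit_uminus)
lift_definition times_qcoeff :: "'a qcoeff \<Rightarrow> 'a qcoeff \<Rightarrow> 'a qcoeff" is "(*)"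
  by (rule adjoin_unit.mult)

instance
  by standard (transfer; simp add: algebra_simps)+

end

text \<open>\<open>qhalf n\<close> is \<open>q\<close> to the power \<open>n/2\<close>.\<close>

lift_definition qhalf :: "int \<Rightarrow> 'k::{field,finite} qcoeff"
  is "\<lambda>n. sqrt (real CARD('k)) powi n" by (rule adjoin_unit_powi)

lemma qhalf_0 [simp]: "qhalf 0 = 1"
  by transfer simp

lemma qhalf_add: "qhalf (m + n) = qhalf m * qhalf n"
  by transfer (simp add: power_int_add)

lemma qhalf_2: "(qhalf 2 :: 'k::{field,finite} qcoeff) = of_nat CARD('k)"
proof -
  have "Rep_qcoeff (of_nat n :: 'k qcoeff) = real n" for n
    by (induction n) (simp_all add: zero_qcoeff.rep_eq one_qcoeff.rep_eq plus_qcoeff.rep_eq)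
  then show ?thesis
    by (simp add: qhalf.rep_eq flip: Rep_qcoeff_inject)
qed

lifting_forget qcoeff.lifting


section \<open>The quantum torus\<close>

type_synonym int4 = "int \<times> int \<times> int \<times> int"

fun Lam :: "int4 \<Rightarrow> int4 \<Rightarrow> int" where
  "Lam (a1, a2, a3, a4) (b1, b2, b3, b4) =
     - (a1 * b3 - a3 * b1) - (a2 * b4 - a4 * b2) - 2 * (a3 * b4 - a4 * b3)"

lemma Lam_add_left: "Lam (a + b) c = Lam a c + Lam b c"
  by (cases a; cases b; cases c) (simp add: algebra_simps)

lemma Lam_add_right: "Lam a (b + c) = Lam a b + Lam a c"
  by (cases a; cases b; cases c) (simp add: algebra_simps)

lemma Lam_0_left [simp]: "Lam 0 a = 0"
  by (cases a) (simp add: zero_prod_def)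

lemma Lam_0_right [simp]: "Lam a 0 = 0"
  by (cases a) (simp add: zero_prod_def)

lemma Lam_skew: "Lam a b = - Lam b a"
  by (cases a; cases b) (simp add: algebra_simps)

text \<open>An element is given by its finitely many coefficients in the basis of monomials.\<close>

typedef (overloaded) 'k qtorus =
  "{f :: int4 \<Rightarrow> 'k::{field,finite} qcoeff. finite {e. f e \<noteq> 0}}"
  morphisms qt_coeff Abs_qtorus
  by (rule exI[of _ "\<lambda>_. 0"]) simp

setup_lifting type_definition_qtorus

lemma qtorus_eqI: "(\<And>e. qt_coeff f e = qt_coeff g e) \<Longrightarrow> f = g"
  by (metis ext qt_coeff_inject)

lemma finite_support [simp]: "finite {e. qt_coeff f e \<noteq> 0}"
  using qt_coeff[of f] by simp

lift_definition qX :: "int4 \<Rightarrow> 'k::{field,finite} qtorus"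
  is "\<lambda>a e. if e = a then 1 else 0"
  by simp

lift_definition qscale :: "'k::{field,finite} qcoeff \<Rightarrow> 'k qtorus \<Rightarrow> 'k qtorus"
  is "\<lambda>c f e. c * f e"
  by (erule rev_finite_subset) auto

text \<open>The product is the bilinear extension of the twisted product of monomials; see
  \<open>qX_mult\<close> below.\<close>

definition twisted_mult ::
    "(int4 \<Rightarrow> 'k::{field,finite} qcoeff) \<Rightarrow> (int4 \<Rightarrow> 'k qcoeff) \<Rightarrow> int4 \<Rightarrow> 'k qcoeff" where
  "twisted_mult f g e = (\<Sum>a | f a \<noteq> 0. f a * g (e - a) * qhalf (Lam a (e - a)))"

lemma twisted_mult_superset:
  assumes "finite A" "{a. f a \<noteq> 0} \<subseteq> A"
  shows "twisted_mult f g e = (\<Sum>a\<in>A. f a * g (e - a) * qhalf (Lam a (e - a)))"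
  unfolding twisted_mult_def by (rule sum.mono_neutral_left) (use assms in simp_all)

lemma twisted_mult_support:
  "{e. twisted_mult f g e \<noteq> 0} \<subseteq> (\<lambda>(a, b). a + b) ` ({a. f a \<noteq> 0} \<times> {b. g b \<noteq> 0})"
proof
  fix e assume "e \<in> {e. twisted_mult f g e \<noteq> 0}"
  then have "(\<Sum>a | f a \<noteq> 0. f a * g (e - a) * qhalf (Lam a (e - a))) \<noteq> 0"
    by (simp add: twisted_mult_def)
  then obtain a where a: "a \<in> {a. f a \<noteq> 0}" "f a * g (e - a) * qhalf (Lam a (e - a)) \<noteq> 0"
    by (rule sum.not_neutral_contains_not_neutral)
  have "g (e - a) \<noteq> 0"
  proof
    assume "g (e - a) = 0"
    with a(2) show False by simp
  qed
  then have "(a, e - a) \<in> {a. f a \<noteq> 0} \<times> {b. g b \<noteq> 0}"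
    using a(1) by simp
  then show "e \<in> (\<lambda>(a, b). a + b) ` ({a. f a \<noteq> 0} \<times> {b. g b \<noteq> 0})"
    by (rule rev_image_eqI) simp
qed

lemma finite_twisted_mult:
  assumes "finite {a. f a \<noteq> 0}" "finite {b. g b \<noteq> 0}"
  shows "finite {e. twisted_mult f g e \<noteq> 0}"
  by (rule finite_subset[OF twisted_mult_support])
    (intro finite_imageI finite_cartesian_product assms)

lemma twisted_mult_assoc:
  assumes f: "finite {a. f a \<noteq> 0}" and g: "finite {b. g b \<noteq> 0}"
  shows "twisted_mult (twisted_mult f g) h e = twisted_mult f (twisted_mult g h) e"
proof -
  define A where "A = {a. f a \<noteq> 0}"
  define B where "B = {b. g b \<noteq> 0}"
  define C where "C = (\<lambda>(a, b). a + b) ` (A \<times> B)"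
  have fin: "finite A" "finite B" "finite C"
    unfolding C_def by (simp_all add: A_def B_def f g)
  have inner: "(\<Sum>c\<in>C. f a * g (c - a) * qhalf (Lam a (c - a)) * h (e - c) * qhalf (Lam c (e - c)))
      = f a * twisted_mult g h (e - a) * qhalf (Lam a (e - a))" (is "?l = ?r")
    if a: "a \<in> A" for a
  proof -
    let ?t = "\<lambda>c. f a * g (c - a) * qhalf (Lam a (c - a)) * h (e - c) * qhalf (Lam c (e - c))"
    have sub: "(+) a ` B \<subseteq> C"
    proof
      fix c assume "c \<in> (+) a ` B"
      then obtain b where "b \<in> B" "c = a + b" by (rule imageE)
      then show "c \<in> C"
        unfolding C_def using a by (intro rev_image_eqI[of "(a, b)"]) simp_all
    qed
    have zero: "?t c = 0" if "c \<notin> (+) a ` B" for c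
    proof -
      have "c - a \<notin> B"
      proof
        assume "c - a \<in> B"
        then have "c \<in> (+) a ` B" by (rule rev_image_eqI) simp
        with that show False ..
      qed
      then show ?thesis
        by (simp add: B_def)
    qed
    have "?l = (\<Sum>c\<in>(+) a ` B. ?t c)"
    proof (rule sum.mono_neutral_right[OF fin(3) sub], rule ballI)
      fix c assume "c \<in> C - (+) a ` B"
      then show "?t c = 0" by (intro zero) simp
    qed
    also have "\<dots> = (\<Sum>b\<in>B. ?t (a + b))"
      by (subst sum.reindex) (simp_all add: o_def)
    also have "\<dots> = (\<Sum>b\<in>B. f a * qhalf (Lam a (e - a)) *
        (g b * h (e - a - b) * qhalf (Lam b (e - a - b))))"
    proof (rule sum.cong)
      fix b
      have "Lam a b + Lam (a + b) (e - (a + b)) = Lam a (e - a) + Lam b (e - a - b)"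
        using Lam_add_right[of a b "e - a - b"] Lam_add_left[of a b "e - a - b"]
        by (simp add: algebra_simps)
      then have *: "qhalf (Lam a b) * qhalf (Lam (a + b) (e - (a + b)))
          = (qhalf (Lam a (e - a)) * qhalf (Lam b (e - a - b)) :: 'a qcoeff)"
        by (simp only: flip: qhalf_add)
      have "?t (a + b) = f a * g b * h (e - (a + b)) *
          (qhalf (Lam a b) * qhalf (Lam (a + b) (e - (a + b))))"
        by (simp only: add_diff_cancel_left' mult.assoc mult.commute mult.left_commute)
      also have "\<dots> = f a * qhalf (Lam a (e - a)) *
          (g b * h (e - a - b) * qhalf (Lam b (e - a - b)))"
        by (simp only: * diff_diff_eq mult.assoc mult.commute mult.left_commute)
      finally show "?t (a + b) = f a * qhalf (Lam a (e - a)) *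
          (g b * h (e - a - b) * qhalf (Lam b (e - a - b)))" .
    qed simp
    also have "\<dots> = f a * qhalf (Lam a (e - a)) * twisted_mult g h (e - a)"
      by (simp add: twisted_mult_def B_def sum_distrib_left)
    finally show ?thesis
      by (simp only: mult.assoc mult.commute mult.left_commute)
  qed
  have "twisted_mult (twisted_mult f g) h e
      = (\<Sum>c\<in>C. twisted_mult f g c * h (e - c) * qhalf (Lam c (e - c)))"
    by (rule twisted_mult_superset[OF fin(3)], unfold C_def A_def B_def)
      (rule twisted_mult_support)
  also have "\<dots> = (\<Sum>c\<in>C. \<Sum>a\<in>A.
      f a * g (c - a) * qhalf (Lam a (c - a)) * h (e - c) * qhalf (Lam c (e - c)))"
    by (simp add: twisted_mult_def A_def sum_distrib_right)
  also have "\<dots> = (\<Sum>a\<in>A. f a * twisted_mult g h (e - a) * qhalf (Lam a (e - a)))"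
    by (subst sum.swap) (rule sum.cong[OF refl inner])
  finally show ?thesis
    by (simp add: twisted_mult_def[of f] A_def)
qed

lemma finite_support_add:
  fixes f g :: "'a \<Rightarrow> 'b::group_add"
  assumes "finite {e. f e \<noteq> 0}" "finite {e. g e \<noteq> 0}"
  shows "finite {e. f e + g e \<noteq> 0}"
proof (rule finite_subset[OF _ finite_UnI[OF assms]])
  show "{e. f e + g e \<noteq> 0} \<subseteq> {e. f e \<noteq> 0} \<union> {e. g e \<noteq> 0}"
    by (rule subsetI, rule ccontr) simp
qed

lemma finite_support_diff:
  fixes f g :: "'a \<Rightarrow> 'b::group_add"
  assumes "finite {e. f e \<noteq> 0}" "finite {e. g e \<noteq> 0}"
  shows "finite {e. f e - g e \<noteq> 0}"
proof (rule finite_subset[OF _ finite_UnI[OF assms]])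
  show "{e. f e - g e \<noteq> 0} \<subseteq> {e. f e \<noteq> 0} \<union> {e. g e \<noteq> 0}"
    by (rule subsetI, rule ccontr) simp
qed

instantiation qtorus :: ("{field,finite}") ring_1
begin

lift_definition zero_qtorus :: "'a qtorus" is "\<lambda>_. 0" by simp
definition one_qtorus :: "'a qtorus" where "one_qtorus = qX 0"
lift_definition plus_qtorus :: "'a qtorus \<Rightarrow> 'a qtorus \<Rightarrow> 'a qtorus" is "\<lambda>f g e. f e + g e"
  by (rule finite_support_add)
lift_definition minus_qtorus :: "'a qtorus \<Rightarrow> 'a qtorus \<Rightarrow> 'a qtorus" is "\<lambda>f g e. f e - g e"
  by (rule finite_support_diff)
lift_definition uminus_qtorus :: "'a qtorus \<Rightarrow> 'a qtorus" is "\<lambda>f e. - f e"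
  by simp
lift_definition times_qtorus :: "'a qtorus \<Rightarrow> 'a qtorus \<Rightarrow> 'a qtorus" is twisted_mult
  by (rule finite_twisted_mult)

instance
proof
  fix a b c :: "'a qtorus"
  show "a * b * c = a * (b * c)"
    by (rule qtorus_eqI) (simp add: times_qtorus.rep_eq twisted_mult_assoc)
  show "1 * a = a"
  proof (rule qtorus_eqI)
    fix e
    have "qt_coeff (1 * a) e = (\<Sum>x\<in>{0}. (if x = 0 then 1 else 0) * qt_coeff a (e - x) * qhalf (Lam x (e - x)))"
      unfolding times_qtorus.rep_eq one_qtorus_def qX.rep_eq
      by (rule twisted_mult_superset) simp_all
    then show "qt_coeff (1 * a) e = qt_coeff a e"
      by simp
  qed
  show "a * 1 = a"
  proof (rule qtorus_eqI)
    fix e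
    have *: "qt_coeff a x * (if e - x = 0 then 1 else 0) * qhalf (Lam x (e - x))
        = (if e = x then qt_coeff a x else 0)" for x
      by (cases "e = x") simp_all
    show "qt_coeff (a * 1) e = qt_coeff a e"
      unfolding times_qtorus.rep_eq one_qtorus_def qX.rep_eq twisted_mult_def *
      by (simp only: sum.delta'[OF finite_support]) simp
  qed
  show "(a + b) * c = a * c + b * c"
  proof (rule qtorus_eqI)
    fix e
    let ?A = "{x. qt_coeff a x \<noteq> 0} \<union> {x. qt_coeff b x \<noteq> 0}"
    have fin: "finite ?A"
      by (intro finite_UnI finite_support)
    have "{x. qt_coeff a x + qt_coeff b x \<noteq> 0} \<subseteq> ?A"
      by (rule subsetI, rule ccontr) simp
    note ab = twisted_mult_superset[OF fin this]
    note a = twisted_mult_superset[OF fin Un_upper1]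
    note b = twisted_mult_superset[OF fin Un_upper2]
    show "qt_coeff ((a + b) * c) e = qt_coeff (a * c + b * c) e"
      unfolding times_qtorus.rep_eq plus_qtorus.rep_eq ab a b
      by (simp only: distrib_right sum.distrib)
  qed
  show "a * (b + c) = a * b + a * c"
    by (rule qtorus_eqI)
      (simp only: times_qtorus.rep_eq plus_qtorus.rep_eq twisted_mult_def
        distrib_left distrib_right sum.distrib)
  have "qt_coeff (0 :: 'a qtorus) 0 \<noteq> qt_coeff 1 0"
    by (simp add: one_qtorus_def qX.rep_eq zero_qtorus.rep_eq)
  then show "(0 :: 'a qtorus) \<noteq> 1"
    by metis
qed (rule qtorus_eqI,
    simp add: plus_qtorus.rep_eq minus_qtorus.rep_eq uminus_qtorus.rep_eq zero_qtorus.rep_eq)+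

end

lemma qt_coeff_sum: "qt_coeff (\<Sum>i\<in>I. f i) e = (\<Sum>i\<in>I. qt_coeff (f i) e)"
  by (induction I rule: infinite_finite_induct) (simp_all add: zero_qtorus.rep_eq plus_qtorus.rep_eq)

lemma qX_mult: "qX e * qX f = qscale (qhalf (Lam e f)) (qX (e + f))"
proof (rule qtorus_eqI)
  fix d
  have "qt_coeff (qX e * qX f) d
      = (\<Sum>a\<in>{e}. (if a = e then 1 else 0) * (if d - a = f then 1 else 0) * qhalf (Lam a (d - a)))"
    unfolding times_qtorus.rep_eq qX.rep_eq by (rule twisted_mult_superset) simp_all
  then show "qt_coeff (qX e * qX f) d = qt_coeff (qscale (qhalf (Lam e f)) (qX (e + f))) d"
    by (cases "d = e + f") (simp_all add: qscale.rep_eq qX.rep_eq diff_eq_eq add.commute)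
qed

lemma qscale_mult_left: "qscale c f * g = qscale c (f * g)"
proof (rule qtorus_eqI)
  fix d
  have "{a. c * qt_coeff f a \<noteq> 0} \<subseteq> {a. qt_coeff f a \<noteq> 0}"
    by (intro Collect_mono impI notI) simp
  note * = twisted_mult_superset[OF finite_support this]
  show "qt_coeff (qscale c f * g) d = qt_coeff (qscale c (f * g)) d"
    unfolding times_qtorus.rep_eq qscale.rep_eq * by (simp add: twisted_mult_def sum_distrib_left mult.assoc)
qed

lemma qscale_mult_right: "f * qscale c g = qscale c (f * g)"
  by (rule qtorus_eqI)
    (simp add: times_qtorus.rep_eq qscale.rep_eq twisted_mult_def sum_distrib_left mult_ac)

lemma qtorus_expand: "f = (\<Sum>e | qt_coeff f e \<noteq> 0. qscale (qt_coeff f e) (qX e))"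
proof (rule qtorus_eqI)
  fix d
  have *: "qt_coeff f e * (if d = e then 1 else 0) = (if d = e then qt_coeff f e else 0)" for e
    by simp
  show "qt_coeff f d = qt_coeff (\<Sum>e | qt_coeff f e \<noteq> 0. qscale (qt_coeff f e) (qX e)) d"
    unfolding qt_coeff_sum qscale.rep_eq qX.rep_eq *
    by (simp only: sum.delta'[OF finite_support]) simp
qed


section \<open>Modules over the Kronecker quiver\<close>

definition fscale :: "'k::field \<Rightarrow> (nat \<Rightarrow> 'k) \<Rightarrow> nat \<Rightarrow> 'k" where
  "fscale c v = (\<lambda>i. c * v i)"

interpretation fv: vector_space "fscale :: 'k::field \<Rightarrow> (nat \<Rightarrow> 'k) \<Rightarrow> nat \<Rightarrow> 'k"
  by standard (auto simp: fscale_def algebra_simps)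

text \<open>A finite-dimensional \<open>kQ\<close>-module is a representation of \<open>Q\<close>: a vector space at each of
  the vertices 1 and 2, and for each of the two arrows a linear map from the first space to the
  second. The spaces are finite-dimensional subspaces of the space of all sequences over the
  field, which contains a copy of every finite-dimensional space. The maps are restrictions of
  linear maps on the whole sequence space (every linear map on a subspace is one); their values
  outside the first space are irrelevant.\<close>

record 'k krep =
  sp1 :: "(nat \<Rightarrow> 'k) set"
  sp2 :: "(nat \<Rightarrow> 'k) set"
  arr_a :: "(nat \<Rightarrow> 'k) \<Rightarrow> nat \<Rightarrow> 'k"
  arr_b :: "(nat \<Rightarrow> 'k) \<Rightarrow> nat \<Rightarrow> 'k"

definition fin_dim_subspace :: "(nat \<Rightarrow> 'k::field) set \<Rightarrow> bool" where
  "fin_dim_subspace S \<longleftrightarrow> (\<exists>B. finite B \<and> fv.span B = S)"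

definition is_krep :: "'k::field krep \<Rightarrow> bool" where
  "is_krep M \<longleftrightarrow>
     fin_dim_subspace (sp1 M) \<and> fin_dim_subspace (sp2 M) \<and>
     Vector_Spaces.linear fscale fscale (arr_a M) \<and> arr_a M ` sp1 M \<subseteq> sp2 M \<and>
     Vector_Spaces.linear fscale fscale (arr_b M) \<and> arr_b M ` sp1 M \<subseteq> sp2 M"

definition zero_krep :: "'k::field krep \<Rightarrow> bool" where
  "zero_krep M \<longleftrightarrow> sp1 M = {0} \<and> sp2 M = {0}"

definition dimvec :: "'k::field krep \<Rightarrow> nat \<times> nat" where
  "dimvec M = (fv.dim (sp1 M), fv.dim (sp2 M))"

definition submods :: "'k::field krep \<Rightarrow> ((nat \<Rightarrow> 'k) set \<times> (nat \<Rightarrow> 'k) set) set" where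
  "submods M = {(U, W).
     fv.subspace U \<and> U \<subseteq> sp1 M \<and> fv.subspace W \<and> W \<subseteq> sp2 M \<and>
     arr_a M ` U \<subseteq> W \<and> arr_b M ` U \<subseteq> W}"

definition Gr :: "nat \<times> nat \<Rightarrow> 'k::field krep \<Rightarrow> ((nat \<Rightarrow> 'k) set \<times> (nat \<Rightarrow> 'k) set) set" where
  "Gr e M = {(U, W) \<in> submods M. (fv.dim U, fv.dim W) = e}"

definition indecomposable :: "'k::field krep \<Rightarrow> bool" where
  "indecomposable M \<longleftrightarrow> \<not> zero_krep M \<and>
     (\<forall>(U, W) \<in> submods M. \<forall>(U', W') \<in> submods M.
        U \<inter> U' = {0} \<and> fv.span (U \<union> U') = sp1 M \<and>
        W \<inter> W' = {0} \<and> fv.span (W \<union> W') = sp2 M \<longrightarrow>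
        (U = {0} \<and> W = {0}) \<or> (U' = {0} \<and> W' = {0}))"

text \<open>The Bernstein-Gelfand-Ponomarev reflections. Reflecting at the sink 2 (resp. the source 1)
  reverses both arrows, which gives the Kronecker quiver again with the roles of the vertices
  exchanged. So in both cases the first space of the reflected module \<open>N\<close> sits at vertex 2 and
  the second one at vertex 1. At the sink, the new space is the kernel of the map
  \<open>M\<^sub>1 \<oplus> M\<^sub>1 \<rightarrow> M\<^sub>2\<close> given by the arrows, and the new maps are its two projections; at the source,
  the new space is the cokernel of \<open>M\<^sub>1 \<rightarrow> M\<^sub>2 \<oplus> M\<^sub>2\<close>, and the new maps are the two inclusions
  followed by the quotient map. Kernel and cokernel being determined up to isomorphism, these are
  relations.\<close>

definition sink_reflection :: "'k::field krep \<Rightarrow> 'k krep \<Rightarrow> bool" where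
  "sink_reflection M N \<longleftrightarrow> is_krep N \<and> sp2 N = sp1 M \<and>
     bij_betw (\<lambda>v. (arr_a N v, arr_b N v)) (sp1 N)
       {(u, w) \<in> sp1 M \<times> sp1 M. arr_a M u + arr_b M w = 0}"

definition source_reflection :: "'k::field krep \<Rightarrow> 'k krep \<Rightarrow> bool" where
  "source_reflection M N \<longleftrightarrow> is_krep N \<and> sp1 N = sp2 M \<and>
     (\<lambda>(u, w). arr_a N u + arr_b N w) ` (sp1 N \<times> sp1 N) = sp2 N \<and>
     {(u, w) \<in> sp1 N \<times> sp1 N. arr_a N u + arr_b N w = 0}
       = (\<lambda>v. (arr_a M v, arr_b M v)) ` sp1 M"

text \<open>The Auslander-Reiten translates are the Coxeter functors, i.e. the composites of two
  reflections. (In general this holds up to a change of sign of the arrows, which for this quiver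
  does not change the isomorphism class.) A module is preprojective (preinjective) if
  some power of the translate (of the inverse translate) sends it to zero.\<close>

definition ar_translate :: "'k::field krep \<Rightarrow> 'k krep \<Rightarrow> bool" where
  "ar_translate = sink_reflection OO sink_reflection"

definition ar_translate_inv :: "'k::field krep \<Rightarrow> 'k krep \<Rightarrow> bool" where
  "ar_translate_inv = source_reflection OO source_reflection"

definition preprojective :: "'k::field krep \<Rightarrow> bool" where
  "preprojective M \<longleftrightarrow> (\<exists>Z. ar_translate\<^sup>*\<^sup>* M Z \<and> zero_krep Z)"

definition preinjective :: "'k::field krep \<Rightarrow> bool" where
  "preinjective M \<longleftrightarrow> (\<exists>Z. ar_translate_inv\<^sup>*\<^sup>* M Z \<and> zero_krep Z)"

text \<open>The modules \<open>V l\<close> are determined up to isomorphism only, so \<open>V\<close> is any choice of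
  representatives. Its values at 1 and 2 are not used.\<close>

definition kronecker_modules :: "(int \<Rightarrow> 'k::field krep) \<Rightarrow> bool" where
  "kronecker_modules V \<longleftrightarrow>
     (\<forall>l::nat. is_krep (V (- int l)) \<and> indecomposable (V (- int l)) \<and>
        preprojective (V (- int l)) \<and> dimvec (V (- int l)) = (l, l + 1)) \<and>
     (\<forall>l::nat. is_krep (V (int l + 3)) \<and> indecomposable (V (int l + 3)) \<and>
        preinjective (V (int l + 3)) \<and> dimvec (V (int l + 3)) = (l + 1, l))"


section \<open>Quantum cluster characters, cluster variables and Chebyshev elements\<close>

fun euler_form :: "int \<times> int \<Rightarrow> int \<times> int \<Rightarrow> int" where
  "euler_form (a1, a2) (b1, b2) = a1 * b1 + a2 * b2 - 2 * a1 * b2"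

definition qchar :: "'k::{field,finite} krep \<Rightarrow> 'k qtorus" where
  "qchar M = (case dimvec M of (m1, m2) \<Rightarrow>
     \<Sum>(e1, e2) \<in> {0..m1} \<times> {0..m2}.
       qscale
         (of_nat (card (Gr (e1, e2) M)) *
          qhalf (- euler_form (int e1, int e2) (int m1 - int e1, int m2 - int e2)))
         (qX (2 * int m2 - int m1 - 2 * int e2, 2 * int e1 - int m2,
              int m1 - int e1, int m2 - int e2)))"

definition cluster_var :: "(int \<Rightarrow> 'k::{field,finite} krep) \<Rightarrow> int \<Rightarrow> 'k qtorus" where
  "cluster_var V l =
     (if l = 1 then qX (1, 0, 0, 0) else if l = 2 then qX (0, 1, 0, 0) else qchar (V l))"

definition X_delta :: "'k::{field,finite} qtorus" where
  "X_delta = qX (1, -1, 1, 1) + qX (-1, -1, 1, 0) + qX (-1, 1, 0, 0)"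

fun cheb :: "nat \<Rightarrow> 'k::{field,finite} qtorus" where
  "cheb 0 = 1"
| "cheb (Suc 0) = X_delta"
| "cheb (Suc (Suc 0)) = X_delta * X_delta - 2 * qX (0, 0, 1, 1)"
| "cheb (Suc (Suc (Suc n))) = cheb (Suc (Suc n)) * X_delta - qX (0, 0, 1, 1) * cheb (Suc n)"

end

theory Submission
  imports Defs
begin

text \<open>
  Write \<open>Y\<close> for the monomial \<open>X\<close> with exponent \<open>(0,0,1,1)\<close>; it commutes with \<open>X_delta\<close>.

  \<^bold>\<open>Reduction to one relation.\<close> The corrections by powers of \<open>q\<close> and by coefficients in the second
  and fourth formula disappear after a renormalization: multiplying the variables with positive
  index from the left by suitable monomials in the coefficients gives a family \<open>L\<close> indexed by all
  integers (\<open>left_var\<close>) with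
    \<open>X_delta * L j = L (j - 1) + Y * L (j + 1)\<close> for every integer \<open>j\<close> (\<open>X_delta_mult_left_var\<close>),
  and a second family \<open>R\<close> (\<open>right_var\<close>) satisfies the mirror relation for multiplication from the
  right (\<open>right_var_mult_X_delta\<close>). The Chebyshev recursion turns a three-term relation of this
  kind into \<open>F\<^sub>m * L j = L (j - m) + Y\<^sup>m * L (j + m)\<close>; translating back to the cluster variables gives the four formulas.

  \<^bold>\<open>The relation on coefficients.\<close> After renormalization no power of \<open>q\<close> is left in front of the
  coefficients, and both families have the same coefficients (\<open>cluster_coef\<close>): products of two
  Gaussian binomials in their symmetric normalization, i.e. multiplied by the power of \<open>q\<close> that
  makes them invariant under \<open>q \<mapsto> 1/q\<close>. The three-term relation is a combination of three
  instances of the q-Pascal rule (\<open>char_coef_rec\<close>). The relation for the right-hand family is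
  the same identity with \<open>q\<close> replaced by \<open>1/q\<close>; it holds because the symmetric binomials satisfy
  both q-Pascal rules.

  \<^bold>\<open>Counting submodules.\<close> The coefficients come from
    \<open>|Gr\<^sub>(\<^sub>a\<^sub>,\<^sub>b\<^sub>) V(-l)| = [l+1-a, b-a] [b-1, a]\<close> and \<open>|Gr\<^sub>(\<^sub>a\<^sub>,\<^sub>b\<^sub>) V(l+3)| = [b+1, a] [l-a, l-b]\<close>,
  where \<open>[n, k]\<close> is a Gaussian binomial and \<open>[-1, 0] = 1\<close>. These formulas are proved by induction
  along reflections (\<open>card_Gr_sink_chain\<close>, \<open>card_Gr_source_chain\<close>). If
  \<open>N\<close> is the sink reflection of \<open>M\<close>, then \<open>M\<^sub>1 = N\<^sub>2\<close>, and for a subspace \<open>W\<close> of this space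
  the submodule of \<open>M\<close> generated by \<open>W\<close> and the largest submodule of \<open>N\<close> with second space
  \<open>W\<close> have dimensions determined by each other (\<open>linked\<close>). Submodules of \<open>M\<close>, resp. \<open>N\<close>,
  with prescribed dimension vector are counted by summing a Gaussian binomial over such \<open>W\<close>.
  Hence either count, in all dimension vectors, determines how many \<open>W\<close> there are of each kind,
  because the linear system is triangular, and then the other count (\<open>qbinom_sum_transfer\<close>). Along
  the chain of reflections that leads a module with dimension vector \<open>(l, l+1)\<close> or \<open>(l+1, l)\<close> to
  zero, the dimensions form a convex sequence, which forces them to drop by exactly one in every
  step. So the explicit formulas follow from the definition of preprojective and preinjective
  modules by reflections, without a normal form of the modules.
\<close>

section \<open>Gaussian binomial coefficients\<close>

text \<open>The Gaussian binomial coefficient \<open>[n, k]\<close> at \<open>q\<close>, as a natural number, since it counts subspaces.\<close>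

fun qbinom :: "nat \<Rightarrow> nat \<Rightarrow> nat \<Rightarrow> nat" where
  "qbinom q n 0 = 1"
| "qbinom q 0 (Suc k) = 0"
| "qbinom q (Suc n) (Suc k) = qbinom q n k + q ^ Suc k * qbinom q n (Suc k)"

lemma qbinom_eq_0: "n < k \<Longrightarrow> qbinom q n k = 0"
proof (induction n arbitrary: k)
  case 0
  then show ?case by (cases k) auto
next
  case (Suc n)
  then show ?case by (cases k) auto
qed

lemma qbinom_self [simp]: "qbinom q n n = 1"
  by (induction n) (auto simp: qbinom_eq_0)

text \<open>Up to the factor \<open>(q - 1)\<^sup>n\<close> this is the q-factorial; in this form denominators are cleared.\<close>

definition qfac :: "nat \<Rightarrow> nat \<Rightarrow> int" where
  "qfac q n = (\<Prod>i<n. int q ^ Suc i - 1)"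

lemma qfac_Suc: "qfac q (Suc n) = qfac q n * (int q ^ Suc n - 1)"
  by (simp add: qfac_def)

lemma qfac_nonzero:
  assumes "2 \<le> q" shows "qfac q n \<noteq> 0"
proof -
  have "int q ^ Suc i - 1 \<noteq> 0" for i
    using power_gt1[of "int q" i] assms by simp
  then show ?thesis by (simp add: qfac_def)
qed

text \<open>The closed formula for the Gaussian binomial. Symmetry, absorption and the trinomial identity are immediate from it, since \<open>qfac\<close> can be cancelled for \<open>q \<ge> 2\<close>.\<close>

lemma qbinom_qfac: "int (qbinom q (m + n) m) * qfac q m * qfac q n = qfac q (m + n)"
proof (induction "m + n" arbitrary: m n rule: less_induct)
  case less
  show ?case
  proof (cases m)
    case 0
    then show ?thesis by (simp add: qfac_def)
  next
    case (Suc m')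
    show ?thesis
    proof (cases n)
      case 0
      then show ?thesis by (simp add: qfac_def)
    next
      case n: (Suc n')
      have 1: "int (qbinom q (m' + n) m') * qfac q m' * qfac q n = qfac q (m' + n)"
        and 2: "int (qbinom q (m + n') m) * qfac q m * qfac q n' = qfac q (m + n')"
        by (rule less; simp add: Suc n)+
      have eq: "m + n' = m' + n" "m + n = Suc (m' + n)"
        by (simp_all add: Suc n)
      define Q where "Q i = int q ^ i" for i
      have "qbinom q (m + n) m = qbinom q (m' + n) m' + q ^ m * qbinom q (m + n') m"
        by (simp add: Suc n)
      then have g: "int (qbinom q (m + n) m) = int (qbinom q (m' + n) m') + Q m * int (qbinom q (m + n') m)"
        by (simp only: of_nat_add of_nat_mult of_nat_power Q_def)
      have f: "qfac q m = qfac q m' * (Q m - 1)" "qfac q n = qfac q n' * (Q n - 1)"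
        by (simp_all only: Suc n qfac_Suc Q_def)
      have "int (qbinom q (m + n) m) * qfac q m * qfac q n
        = (int (qbinom q (m' + n) m') * qfac q m' * qfac q n) * (Q m - 1)
          + Q m * (int (qbinom q (m + n') m) * qfac q m * qfac q n') * (Q n - 1)"
        unfolding g f by (simp add: algebra_simps)
      also have "\<dots> = qfac q (m' + n) * (Q m - 1) + Q m * qfac q (m + n') * (Q n - 1)"
        by (simp only: 1 2)
      also have "\<dots> = qfac q (m' + n) * (Q m * Q n - 1)"
        unfolding eq by (simp add: algebra_simps)
      also have "Q m * Q n = int q ^ Suc (m' + n)"
        by (simp only: Q_def power_add[symmetric] eq)
      also have "qfac q (m' + n) * (int q ^ Suc (m' + n) - 1) = qfac q (m + n)"
        unfolding eq qfac_Suc ..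
      finally show ?thesis .
    qed
  qed
qed

lemma qbinom_sym:
  assumes "2 \<le> q" "k \<le> n"
  shows "qbinom q n (n - k) = qbinom q n k"
proof -
  have "int (qbinom q n (n - k)) * (qfac q k * qfac q (n - k)) = int (qbinom q n k) * (qfac q k * qfac q (n - k))"
    using qbinom_qfac[of q "n - k" k] qbinom_qfac[of q k "n - k"] assms(2) by (simp add: mult_ac)
  then show ?thesis
    using qfac_nonzero[OF assms(1)] by simp
qed

text \<open>The mirror image of the defining recursion under \<open>k \<mapsto> n - k\<close>.\<close>

lemma qbinom_pascal_alt:
  assumes "2 \<le> q" "k \<le> n"
  shows "qbinom q (Suc n) (Suc k) = q ^ (n - k) * qbinom q n k + qbinom q n (Suc k)"
proof (cases "k = n")
  case False
  then obtain d where d: "n = Suc (k + d)"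
    using assms(2) less_imp_Suc_add by (metis le_neq_implies_less)
  have "qbinom q (Suc n) (Suc k) = qbinom q (Suc n) (Suc d)"
    using qbinom_sym[OF assms(1), of "Suc k" "Suc n"] d by simp
  also have "\<dots> = qbinom q n d + q ^ Suc d * qbinom q n (Suc d)"
    by simp
  also have "qbinom q n d = qbinom q n (Suc k)"
    using qbinom_sym[OF assms(1), of "Suc k" "n"] d by simp
  also have "qbinom q n (Suc d) = qbinom q n k"
    using qbinom_sym[OF assms(1), of "k" "n"] d by (simp add: Suc_diff_le)
  finally show ?thesis using d by (simp add: Suc_diff_le)
qed (simp add: qbinom_eq_0)

lemma qbinom_absorb:
  assumes "2 \<le> q"
  shows "int (qbinom q (Suc n) (Suc k)) * (int q ^ Suc k - 1) = (int q ^ Suc n - 1) * int (qbinom q n k)"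
proof (cases "k \<le> n")
  case True
  then obtain d where d: "n = k + d" using le_Suc_ex by blast
  have "int (qbinom q (Suc n) (Suc k)) * (int q ^ Suc k - 1) * (qfac q k * qfac q d)
     = (int q ^ Suc n - 1) * int (qbinom q n k) * (qfac q k * qfac q d)"
    using qbinom_qfac[of q k d] qbinom_qfac[of q "Suc k" d] d
    by (simp add: qfac_Suc mult_ac)
  then show ?thesis using qfac_nonzero[OF assms] by simp
qed (simp add: qbinom_eq_0)

lemma qbinom_trinomial:
  assumes "2 \<le> q" "a \<le> k" "k \<le> n"
  shows "qbinom q n k * qbinom q k a = qbinom q n a * qbinom q (n - a) (k - a)"
proof -
  obtain c where c: "k = a + c" using assms(2) le_Suc_ex by blast
  obtain d where d: "n = k + d" using assms(3) le_Suc_ex by blast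
  have "int (qbinom q n k * qbinom q k a) * (qfac q a * qfac q c * qfac q d) 
     = int (qbinom q n k) * (int (qbinom q k a) * qfac q a * qfac q c) * qfac q d"
    by simp
  also have "\<dots> = qfac q n"
    using qbinom_qfac[of q k d] unfolding c qbinom_qfac d by simp
  also have "\<dots> = int (qbinom q (a + (c + d)) a) * qfac q a * (int (qbinom q (c + d) c) * qfac q c * qfac q d)"
    unfolding qbinom_qfac d c by (simp add: add.assoc)
  also have "\<dots> = int (qbinom q n a * qbinom q (n - a) (k - a)) * (qfac q a * qfac q c * qfac q d)"
    unfolding d c by (simp add: add.assoc)
  finally show ?thesis
    using qfac_nonzero[OF assms(1)] by (simp flip: of_nat_mult)
qed

text \<open>The q-Vandermonde identity, by induction on \<open>m\<close> with the second Pascal rule. This form of the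
  exponent is the one that does not depend on \<open>a\<close> when \<open>n\<close>, \<open>k\<close>, \<open>j\<close> are all shifted by \<open>a\<close>. For
  this reason one and the same sequence \<open>stratum\<close> solves the equations of the system below for all \<open>a\<close>.\<close>

lemma qbinom_vandermonde:
  assumes "2 \<le> q"
  shows "qbinom q (m + n) k = (\<Sum>j\<le>k. q ^ ((n - j) * (k - j)) * qbinom q m (k - j) * qbinom q n j)"
proof (induction m arbitrary: k)
  case 0
  have "(\<Sum>j\<le>k. q ^ ((n - j) * (k - j)) * qbinom q 0 (k - j) * qbinom q n j) = (\<Sum>j\<in>{k}. q ^ ((n - j) * (k - j)) * qbinom q 0 (k - j) * qbinom q n j)"
    by (rule sum.mono_neutral_right) (auto intro!: qbinom_eq_0)
  then show ?case by simp
next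
  case (Suc m)
  show ?case
  proof (cases k)
    case 0
    then show ?thesis by simp
  next
    case (Suc k')
    show ?thesis
    proof (cases "k' \<le> m + n")
      case False
      have "q ^ ((n - j) * (k - j)) * qbinom q (Suc m) (k - j) * qbinom q n j = 0" if "j \<le> k" for j
      proof -
        have "n < j \<or> Suc m < k - j" using False Suc that by linarith
        then show ?thesis by (auto simp: qbinom_eq_0)
      qed
      then have "(\<Sum>j\<le>k. q ^ ((n - j) * (k - j)) * qbinom q (Suc m) (k - j) * qbinom q n j) = 0"
        by (intro sum.neutral) blast
      then show ?thesis using False Suc by (simp add: qbinom_eq_0)
    next
      case True
      have t: "q ^ ((n - j) * (k - j)) * qbinom q (Suc m) (k - j) * qbinom q n j =
         q ^ (m + n - k') * (q ^ ((n - j) * (k' - j)) * qbinom q m (k' - j) * qbinom q n j)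
         + q ^ ((n - j) * (k - j)) * qbinom q m (k - j) * qbinom q n j" if j: "j \<le> k'" for j
      proof (cases "j \<le> n \<and> k' - j \<le> m")
        case True
        have kj: "k - j = Suc (k' - j)" using j Suc by simp
        have pas: "qbinom q (Suc m) (Suc (k' - j)) = q ^ (m - (k' - j)) * qbinom q m (k' - j) + qbinom q m (Suc (k' - j))"
          using True qbinom_pascal_alt[OF assms] by blast
        have "(n - j) * Suc (k' - j) + (m - (k' - j)) = (m + n - k') + (n - j) * (k' - j)"
        proof -
          obtain n' where n': "n = j + n'" using True le_Suc_ex by blast
          obtain i where i: "k' = j + i" using j le_Suc_ex by blast
          obtain m' where m': "m = i + m'" using True i le_Suc_ex by auto
          show ?thesis by (simp add: n' i m' algebra_simps)
        qed
        then have "q ^ ((n - j) * Suc (k' - j)) * q ^ (m - (k' - j)) = q ^ (m + n - k') * q ^ ((n - j) * (k' - j))"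
          by (simp only: flip: power_add)
        then show ?thesis
          unfolding kj pas distrib_left distrib_right by (simp only: mult.assoc[symmetric])
      next
        case False
        then show ?thesis using j Suc by (auto simp: qbinom_eq_0 Suc_diff_le)
      qed
      have "qbinom q (Suc m + n) k = q ^ (m + n - k') * qbinom q (m + n) k' + qbinom q (m + n) k"
        using qbinom_pascal_alt[OF assms True] Suc by simp
      also have "\<dots> = (\<Sum>j\<le>k'. q ^ (m + n - k') * (q ^ ((n - j) * (k' - j)) * qbinom q m (k' - j) * qbinom q n j)
         + q ^ ((n - j) * (k - j)) * qbinom q m (k - j) * qbinom q n j) + qbinom q n k"
        unfolding Suc.IH sum.distrib by (simp add: Suc sum_distrib_left)
      also have "\<dots> = (\<Sum>j\<le>k'. q ^ ((n - j) * (k - j)) * qbinom q (Suc m) (k - j) * qbinom q n j) + qbinom q n k"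
        by (intro arg_cong2[where f = "(+)"] sum.cong refl t[symmetric]) (simp only: atMost_iff)
      also have "\<dots> = (\<Sum>j\<le>k. q ^ ((n - j) * (k - j)) * qbinom q (Suc m) (k - j) * qbinom q n j)"
        by (simp add: Suc)
      finally show ?thesis .
    qed
  qed
qed

lemma sum_by_value:
  fixes f :: "nat \<Rightarrow> nat"
  assumes "finite S" "h ` S \<subseteq> {..B}"
  shows "(\<Sum>x\<in>S. f (h x)) = (\<Sum>c\<le>B. card {x \<in> S. h x = c} * f c)"
proof -
  have "(\<Sum>x\<in>S. f (h x)) = (\<Sum>c\<le>B. \<Sum>x | x \<in> S \<and> h x = c. f (h x))"
    by (rule sum.group[symmetric]) (use assms in auto)
  also have "\<dots> = (\<Sum>c\<le>B. card {x \<in> S. h x = c} * f c)"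
    by (intro sum.cong refl) auto
  finally show ?thesis .
qed

text \<open>The matrix \<open>[c, a]\<close> is unitriangular, so its linear systems have at most one solution.\<close>

lemma qbinom_triangular:
  assumes "\<And>a. (\<Sum>c\<le>B. N c * qbinom q c a) = (\<Sum>c\<le>B. N' c * qbinom q c a)" "c \<le> B"
  shows "N c = (N' c :: nat)"
  using assms
proof (induction B arbitrary: c)
  case 0
  then show ?case using "0.prems"(1)[of 0] by simp
next
  case (Suc B)
  have z: "(\<Sum>c\<le>B. f c * qbinom q c (Suc B)) = 0" for f
    by (auto simp: qbinom_eq_0)
  have top: "N (Suc B) = N' (Suc B)"
    using Suc.prems(1)[of "Suc B"] by (simp add: z)
  show ?case
  proof (cases "c = Suc B")
    case False
    have "(\<Sum>c\<le>B. N c * qbinom q c a) = (\<Sum>c\<le>B. N' c * qbinom q c a)" for a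
      using Suc.prems(1)[of a] top by simp
    then show ?thesis using Suc.IH False Suc.prems(2) by auto
  qed (use top in simp)
qed

text \<open>For \<open>w \<le> t\<close> and \<open>q\<close> elements in the field, this is the number of \<open>w\<close>-dimensional subspaces \<open>U\<close> of the first space of \<open>V(-t)\<close> for which the
  images of \<open>U\<close> under the two arrows together span a space of dimension \<open>2 w - c\<close>.
  It enters below as the solution of a triangular system.\<close>

definition stratum :: "nat \<Rightarrow> nat \<Rightarrow> nat \<Rightarrow> nat \<Rightarrow> nat" where
  "stratum q t w c = q ^ ((w - 1 - c) * (w - c)) * qbinom q (t + 1 - w) (w - c) * qbinom q (w - 1) c"

lemma stratum_eq_0: "w < c \<Longrightarrow> stratum q t w c = 0"
  by (simp add: stratum_def qbinom_eq_0)

text \<open>The trinomial identity pulls \<open>[w-1, a]\<close> out of the sum, and what remains is q-Vandermonde.\<close>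

lemma sum_stratum_pre:
  assumes "2 \<le> q" "w \<le> t" "w \<le> B"
  shows "(\<Sum>c\<le>B. stratum q t w c * qbinom q c a) = qbinom q (t - a) (w - a) * qbinom q (w - 1) a"
proof -
  have r: "(\<Sum>c\<le>B. stratum q t w c * qbinom q c a) = (\<Sum>c\<le>w. stratum q t w c * qbinom q c a)"
    by (rule sum.mono_neutral_right) (auto simp: stratum_eq_0 assms)
  show ?thesis
  proof (cases "w = 0 \<or> w - 1 < a")
    case True
    then show ?thesis
    proof
      assume "w = 0"
      then show ?thesis unfolding r by (cases a) (auto simp: stratum_def)
    next
      assume a: "w - 1 < a"
      have "stratum q t w c * qbinom q c a = 0" for c
        using a by (cases "c < a") (auto simp: stratum_def qbinom_eq_0)
      then show ?thesis using a by (simp add: qbinom_eq_0)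
    qed
  next
    case False
    then have w: "w \<ge> 1" "a \<le> w - 1" by auto
    have "(\<Sum>c\<le>w. stratum q t w c * qbinom q c a) = (\<Sum>c\<in>(+) a ` {..w - a}. stratum q t w c * qbinom q c a)"
    proof (rule sum.mono_neutral_right)
      show "\<forall>i\<in>{..w} - (+) a ` {..w - a}. stratum q t w i * qbinom q i a = 0"
      proof
        fix i assume i: "i \<in> {..w} - (+) a ` {..w - a}"
        have "i < a"
        proof (rule ccontr)
          assume "\<not> i < a"
          then have "i = a + (i - a)" "i - a \<in> {..w - a}" using i by auto
          then show False using i by blast
        qed
        then show "stratum q t w i * qbinom q i a = 0" by (simp add: qbinom_eq_0)
      qed
    qed (use w in auto)
    also have "\<dots> = (\<Sum>j\<le>w - a. stratum q t w (a + j) * qbinom q (a + j) a)"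
      by (subst sum.reindex) auto
    also have "\<dots> = (\<Sum>j\<le>w - a. qbinom q (w - 1) a * (q ^ ((w - 1 - a - j) * (w - a - j)) * qbinom q (t + 1 - w) (w - a - j) * qbinom q (w - 1 - a) j))"
    proof (rule sum.cong[OF refl])
      fix j
      have "qbinom q (w - 1) (a + j) * qbinom q (a + j) a = qbinom q (w - 1) a * qbinom q (w - 1 - a) j"
      proof (cases "a + j \<le> w - 1")
        case True
        then show ?thesis using qbinom_trinomial[OF assms(1), of a "a + j" "w - 1"] by simp
      next
        case False
        then have "qbinom q (w - 1) (a + j) = 0" "qbinom q (w - 1 - a) j = 0"
          using w by (auto intro!: qbinom_eq_0)
        then show ?thesis by (simp only: mult_0 mult_0_right)
      qed
      then show "stratum q t w (a + j) * qbinom q (a + j) a = qbinom q (w - 1) a * (q ^ ((w - 1 - a - j) * (w - a - j)) * qbinom q (t + 1 - w) (w - a - j) * qbinom q (w - 1 - a) j)"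
        by (simp add: stratum_def mult.assoc mult.left_commute)
    qed
    also have "\<dots> = qbinom q (w - 1) a * qbinom q (t + 1 - w + (w - 1 - a)) (w - a)"
      unfolding qbinom_vandermonde[OF assms(1)] sum_distrib_left ..
    also have "t + 1 - w + (w - 1 - a) = t - a" using w assms by simp
    finally show ?thesis unfolding r by simp
  qed
qed

text \<open>Here the trinomial identity pulls out the other factor, and q-Vandermonde applies again. The case
  distinction in the sum says that \<open>[n, k]\<close> vanishes for negative \<open>k\<close>, which truncated subtraction
  would hide.\<close>

lemma sum_stratum_gen:
  assumes "2 \<le> q" "w \<le> t" "w \<le> B"
  shows "(\<Sum>c\<le>B. stratum q t w c * (if 2 * w - c \<le> b then qbinom q (t + 1 + c - 2 * w) (b + c - 2 * w) else 0))
     = qbinom q (t + 1 - w) (b - w) * qbinom q (b - 1) w"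
proof -
  let ?f = "\<lambda>c. if 2 * w - c \<le> b then qbinom q (t + 1 + c - 2 * w) (b + c - 2 * w) else 0"
  have r: "(\<Sum>c\<le>B. stratum q t w c * ?f c) = (\<Sum>c\<le>w. stratum q t w c * ?f c)"
    by (rule sum.mono_neutral_right) (auto simp: stratum_eq_0 assms)
  consider "w = 0" | "w > 0" "b < w" | "w > 0" "w \<le> b" by linarith
  then show ?thesis
  proof cases
    case 1
    then show ?thesis unfolding r by (simp add: stratum_def)
  next
    case 2
    then have "qbinom q (b - 1) w = 0" by (simp add: qbinom_eq_0)
    then show ?thesis unfolding r using 2 by (auto intro!: sum.neutral)
  next
    case 3
    have "(\<Sum>c\<le>w. stratum q t w c * ?f c) = (\<Sum>c\<le>w. qbinom q (t + 1 - w) (b - w) * (q ^ ((w - 1 - c) * (w - c)) * qbinom q (b - w) (w - c) * qbinom q (w - 1) c))"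
    proof (rule sum.cong[OF refl])
      fix c assume "c \<in> {..w}"
      then have c: "c \<le> w" by simp
      have e: "qbinom q (t + 1 - w) (w - c) * ?f c = qbinom q (t + 1 - w) (b - w) * qbinom q (b - w) (w - c)"
      proof (cases "2 * w - c \<le> b \<and> b \<le> t + 1")
        case True
        have "qbinom q (t + 1 - w) (b - w) * qbinom q (b - w) (w - c) = qbinom q (t + 1 - w) (w - c) * qbinom q (t + 1 - w - (w - c)) (b - w - (w - c))"
          by (rule qbinom_trinomial[OF assms(1)]) (use True c in auto)
        moreover have "t + 1 - w - (w - c) = t + 1 + c - 2 * w" "b - w - (w - c) = b + c - 2 * w"
          using c 3 assms(2) True by auto
        ultimately show ?thesis using True by simp
      next
        case False
        show ?thesis
        proof (cases "2 * w - c \<le> b")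
          case True
          then have b: "b > t + 1" using False by simp
          have "qbinom q (t + 1 - w) (w - c) * qbinom q (t + 1 + c - 2 * w) (b + c - 2 * w) = 0"
          proof (cases "t + 1 + c < 2 * w")
            case True
            then have "t + 1 - w < w - c" using c assms(2) by linarith
            then show ?thesis by (simp add: qbinom_eq_0)
          next
            case f: False
            then show ?thesis using b by (simp add: qbinom_eq_0)
          qed
          moreover have "qbinom q (t + 1 - w) (b - w) = 0"
            using b assms(2) by (intro qbinom_eq_0) linarith
          ultimately show ?thesis using True by simp
        next
          case f: False
          then have "b - w < w - c" using c 3 by linarith
          then show ?thesis using f by (simp add: qbinom_eq_0)
        qed
      qed
      have "stratum q t w c * ?f c = q ^ ((w - 1 - c) * (w - c)) * (qbinom q (t + 1 - w) (w - c) * ?f c) * qbinom q (w - 1) c"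
        by (simp only: stratum_def mult_ac)
      also have "\<dots> = qbinom q (t + 1 - w) (b - w) * (q ^ ((w - 1 - c) * (w - c)) * qbinom q (b - w) (w - c) * qbinom q (w - 1) c)"
        unfolding e by (simp only: mult_ac)
      finally show "stratum q t w c * ?f c = qbinom q (t + 1 - w) (b - w) * (q ^ ((w - 1 - c) * (w - c)) * qbinom q (b - w) (w - c) * qbinom q (w - 1) c)" .
    qed
    also have "\<dots> = qbinom q (t + 1 - w) (b - w) * qbinom q (b - w + (w - 1)) w"
      unfolding qbinom_vandermonde[OF assms(1)] sum_distrib_left ..
    also have "b - w + (w - 1) = b - 1" using 3 by simp
    finally show ?thesis unfolding r .
  qed
qed

text \<open>The numerical content of one reflection. The hypothesis is a triangular system for the numbers of
  elements of \<open>S\<close> on which \<open>h\<close> takes a given value. Its solution is \<open>stratum\<close>, and then any other sum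
  over \<open>S\<close> that depends on \<open>h\<close> only can be evaluated.\<close>

lemma qbinom_sum_transfer:
  assumes q: "2 \<le> q" and w: "w \<le> t" and S: "finite S"
    and pre: "\<And>a. (\<Sum>x\<in>S. qbinom q (h x) a) = qbinom q (t - a) (w - a) * qbinom q (w - 1) a"
  shows "(\<Sum>x\<in>S. if 2 * w - h x \<le> b then qbinom q (t + 1 + h x - 2 * w) (b + h x - 2 * w) else 0)
     = qbinom q (t + 1 - w) (b - w) * qbinom q (b - 1) w"
proof -
  \<comment> \<open>A common bound for the values of \<open>h\<close> and for the support of \<open>stratum\<close>.\<close>
  define B where "B = Max (insert w (h ` S))"
  have B: "w \<le> B" "h ` S \<subseteq> {..B}"
    unfolding B_def using S by (auto intro!: Max_ge)
  note val = sum_by_value[OF S B(2)]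
  have "card {x \<in> S. h x = c} = stratum q t w c" if "c \<le> B" for c
  proof (rule qbinom_triangular[OF _ that])
    fix a
    show "(\<Sum>c\<le>B. card {x \<in> S. h x = c} * qbinom q c a) = (\<Sum>c\<le>B. stratum q t w c * qbinom q c a)"
      unfolding sum_stratum_pre[OF q w B(1)] pre[symmetric] by (rule val[symmetric])
  qed
  then show ?thesis
    unfolding val[of "\<lambda>c. if 2 * w - c \<le> b then qbinom q (t + 1 + c - 2 * w) (b + c - 2 * w) else 0"]
      sum_stratum_gen[OF q w B(1), symmetric]
    by (intro sum.cong refl) (simp del: if_distrib)
qed

section \<open>Subspaces over a finite field\<close>

lemma CARD_field_ge_2: "2 \<le> CARD('k::{field,finite})"
proof -
  have "card {0, 1 :: 'k} \<le> CARD('k)" by (rule card_mono) auto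
  then show ?thesis by simp
qed

lemma CARD_power_eq_iff [simp]: "CARD('k::{field,finite}) ^ m = CARD('k) ^ n \<longleftrightarrow> m = n"
  using CARD_field_ge_2[where 'k = 'k] by (intro power_inject_exp) simp

lemma span_insert_image:
  fixes S :: "(nat \<Rightarrow> 'k::field) set"
  shows "fv.span (insert v S) = (\<lambda>(k, y). fscale k v + y) ` (UNIV \<times> fv.span S)" (is "_ = ?R")
proof
  show "fv.span (insert v S) \<subseteq> ?R"
  proof
    fix x assume "x \<in> fv.span (insert v S)"
    then obtain k where "x - fscale k v \<in> fv.span S"
      unfolding fv.span_insert by blast
    then show "x \<in> ?R"
      by (intro image_eqI[of _ _ "(k, x - fscale k v)"]) auto
  qed
  show "?R \<subseteq> fv.span (insert v S)"
  proof clarify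
    fix k y assume "y \<in> fv.span S"
    then have "fscale k v + y - fscale k v \<in> fv.span S" by simp
    then show "fscale k v + y \<in> fv.span (insert v S)"
      unfolding fv.span_insert by blast
  qed
qed

lemma finite_span:
  fixes S :: "(nat \<Rightarrow> 'k::{field,finite}) set"
  assumes "finite S" shows "finite (fv.span S)"
  using assms by (induction S) (auto simp: span_insert_image)

lemma card_span_insert:
  fixes S :: "(nat \<Rightarrow> 'k::{field,finite}) set"
  assumes v: "v \<notin> fv.span S"
  shows "card (fv.span (insert v S)) = CARD('k) * card (fv.span S)"
proof -
  have "inj_on (\<lambda>(k, y). fscale k v + y) (UNIV \<times> fv.span S)"
  proof (rule inj_onI, clarify)
    fix k k' y y'
    assume y: "y \<in> fv.span S" "y' \<in> fv.span S" and eq: "fscale k v + y = fscale k' v + y'"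
    have "fscale (k - k') v = y' - y"
      using eq by (simp add: fv.scale_left_diff_distrib algebra_simps)
    then have "fscale (k - k') v \<in> fv.span S"
      using fv.span_diff[OF y(2) y(1)] by simp
    then have "fscale (inverse (k - k')) (fscale (k - k') v) \<in> fv.span S"
      by (rule fv.span_scale)
    then have "k = k'" using v by (cases "k = k'") auto
    then show "k = k' \<and> y = y'" using eq by simp
  qed
  then show ?thesis
    unfolding span_insert_image by (simp add: card_image card_cartesian_product)
qed

text \<open>Over a finite field dimensions can be read off from cardinalities; the dimension formulas below are obtained in this way.\<close>

lemma card_subspace:
  fixes S :: "(nat \<Rightarrow> 'k::{field,finite}) set"
  assumes "fv.subspace S" "finite S"
  shows "card S = CARD('k) ^ fv.dim S"
proof -
  obtain B where B: "B \<subseteq> S" "fv.independent B" "S \<subseteq> fv.span B" "card B = fv.dim S"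
    by (rule fv.basis_exists)
  have S: "S = fv.span B"
    using B fv.span_minimal[OF B(1) assms(1)] by blast
  have "finite B" using B(1) assms(2) finite_subset by blast
  then have "card (fv.span B) = CARD('k) ^ card B"
    using B(2)
  proof (induction B)
    case (insert v B)
    then show ?case
      using fv.independent_insert[of v B] by (simp add: card_span_insert)
  qed simp
  then show ?thesis using S B(4) by simp
qed

lemma dim_mono:
  fixes S :: "(nat \<Rightarrow> 'k::{field,finite}) set"
  assumes "fv.subspace S" "fv.subspace T" "S \<subseteq> T" "finite T"
  shows "fv.dim S \<le> fv.dim T"
proof -
  have "CARD('k) ^ fv.dim S \<le> CARD('k) ^ fv.dim T"
    using card_mono[OF assms(4,3)] assms by (simp add: card_subspace finite_subset)
  then show ?thesis
    using CARD_field_ge_2[where 'k = 'k] by (simp add: power_increasing_iff)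
qed

lemma subspace_eqI_dim:
  fixes S :: "(nat \<Rightarrow> 'k::{field,finite}) set"
  assumes "fv.subspace S" "fv.subspace T" "S \<subseteq> T" "finite T" "fv.dim S = fv.dim T"
  shows "S = T"
  using assms by (intro card_subset_eq) (auto simp: card_subspace finite_subset)

lemma dim_span_insert:
  fixes X :: "(nat \<Rightarrow> 'k::{field,finite}) set"
  assumes "fv.subspace X" "finite X" "v \<notin> X"
  shows "fv.dim (fv.span (insert v X)) = Suc (fv.dim X)"
proof -
  have X: "fv.span X = X"
    using assms(1) fv.span_minimal[of X X] fv.span_superset[of X] by blast
  have "CARD('k) ^ fv.dim (fv.span (insert v X)) = card (fv.span (insert v X))"
    using assms by (intro card_subspace[symmetric] finite_span) auto
  also have "\<dots> = CARD('k) ^ Suc (fv.dim X)"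
    using card_span_insert[of v X] assms(3) unfolding X by (simp add: card_subspace assms)
  finally show ?thesis by (simp only: CARD_power_eq_iff)
qed

definition subspaces_between :: "(nat \<Rightarrow> 'k::field) set \<Rightarrow> (nat \<Rightarrow> 'k) set \<Rightarrow> nat \<Rightarrow> (nat \<Rightarrow> 'k) set set" where
  "subspaces_between X Y d = {W. fv.subspace W \<and> X \<subseteq> W \<and> W \<subseteq> Y \<and> fv.dim W = d}"

lemma finite_subspaces_between: "finite Y \<Longrightarrow> finite (subspaces_between X Y d)"
  by (rule finite_subset[of _ "Pow Y"]) (auto simp: subspaces_between_def)

text \<open>Induction on \<open>k\<close>, without quotient spaces: counting the pairs of a subspace \<open>W\<close> of dimension
  \<open>dim X + k + 1\<close> and a vector of \<open>W\<close> outside \<open>X\<close> by the vector leads to the subspaces that contain \<open>X\<close>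
  enlarged by this vector. The resulting recursion is the absorption identity.\<close>

lemma card_subspaces_between_add:
  fixes X Y :: "(nat \<Rightarrow> 'k::{field,finite}) set"
  assumes "fv.subspace X" "fv.subspace Y" "X \<subseteq> Y" "finite Y"
  shows "card (subspaces_between X Y (fv.dim X + k)) = qbinom CARD('k) (fv.dim Y - fv.dim X) k"
  using assms
proof (induction k arbitrary: X)
  case 0
  have "W = X" if "W \<in> subspaces_between X Y (fv.dim X)" for W
    using that "0.prems" subspace_eqI_dim[of X W] finite_subset[of W Y] by (simp add: subspaces_between_def)
  moreover have "X \<in> subspaces_between X Y (fv.dim X)"
    using "0.prems" by (simp add: subspaces_between_def)
  ultimately have "subspaces_between X Y (fv.dim X) = {X}" by blast
  then show ?case by simp
next
  case (Suc k)
  let ?q = "CARD('k)" and ?x = "fv.dim X" and ?y = "fv.dim Y"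
  let ?F = "subspaces_between X Y (?x + Suc k)"
  have finX: "finite X" using Suc.prems finite_subset by blast
  show ?case
  proof (cases "?x = ?y")
    case True
    have "W \<notin> ?F" for W
      using dim_mono[of W Y] Suc.prems True by (auto simp: subspaces_between_def)
    then have "?F = {}" by blast
    then show ?thesis using True by simp
  next
    case False
    then obtain n where n: "?y = Suc (?x + n)"
      using dim_mono[of X Y] Suc.prems less_imp_Suc_add by (metis le_neq_implies_less)
    have "(\<Sum>W\<in>?F. card (W - X)) = (\<Sum>W\<in>?F. \<Sum>v | v \<in> Y - X \<and> v \<in> W. 1)"
      by (intro sum.cong refl) (auto simp: subspaces_between_def intro!: arg_cong[where f = card])
    also have "\<dots> = (\<Sum>v\<in>Y - X. \<Sum>W | W \<in> ?F \<and> v \<in> W. 1)"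
      by (rule sum.swap_restrict) (use Suc.prems in \<open>auto simp: finite_subspaces_between\<close>)
    also have "\<dots> = (\<Sum>v\<in>Y - X. qbinom ?q n k)"
    proof (rule sum.cong[OF refl])
      fix v assume v: "v \<in> Y - X"
      let ?X' = "fv.span (insert v X)"
      have d: "fv.dim ?X' = Suc ?x" using v Suc.prems finX by (intro dim_span_insert) auto
      have "{W. W \<in> ?F \<and> v \<in> W} = subspaces_between ?X' Y (fv.dim ?X' + k)"
      proof -
        have "X \<subseteq> W \<and> v \<in> W \<longleftrightarrow> ?X' \<subseteq> W" if "fv.subspace W" for W
          using fv.span_minimal[of "insert v X" W] fv.span_superset[of "insert v X"] that by blast
        then show ?thesis unfolding subspaces_between_def d[unfolded fv.dim_span] fv.dim_span by auto
      qed
      moreover have "card (subspaces_between ?X' Y (fv.dim ?X' + k)) = qbinom ?q (?y - fv.dim ?X') k"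
        using v Suc.prems fv.span_minimal[of "insert v X" Y] by (intro Suc.IH) auto
      ultimately show "(\<Sum>W | W \<in> ?F \<and> v \<in> W. 1) = qbinom ?q n k"
        using d unfolding n by (simp del: fv.dim_span)
    qed
    also have "\<dots> = (?q ^ ?y - ?q ^ ?x) * qbinom ?q n k"
      using Suc.prems finX by (simp add: card_Diff_subset card_subspace)
    also have "(\<Sum>W\<in>?F. card (W - X)) = (\<Sum>W\<in>?F. ?q ^ (?x + Suc k) - ?q ^ ?x)"
    proof (rule sum.cong[OF refl])
      fix W assume "W \<in> ?F"
      then show "card (W - X) = ?q ^ (?x + Suc k) - ?q ^ ?x"
        using Suc.prems finX finite_subset[of W Y]
        by (auto simp: subspaces_between_def card_Diff_subset card_subspace)
    qed
    finally have "card ?F * (?q ^ (?x + Suc k) - ?q ^ ?x) = (?q ^ ?y - ?q ^ ?x) * qbinom ?q n k"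
      by simp
    then have "?q ^ ?x * (card ?F * (?q ^ Suc k - 1)) = ?q ^ ?x * ((?q ^ Suc n - 1) * qbinom ?q n k)"
      unfolding n by (simp add: power_add algebra_simps diff_mult_distrib2)
    then have "card ?F * (?q ^ Suc k - 1) = (?q ^ Suc n - 1) * qbinom ?q n k"
      using CARD_field_ge_2[where 'k = 'k] by (simp only: mult_cancel1) simp
    then have "int (card ?F) * int (?q ^ Suc k - 1) = int (?q ^ Suc n - 1) * int (qbinom ?q n k)"
      by (simp only: flip: of_nat_mult)
    moreover have "int (?q ^ i - 1) = int ?q ^ i - 1" for i
      by (simp add: of_nat_diff)
    ultimately have "int (card ?F) * (int ?q ^ Suc k - 1) = (int ?q ^ Suc n - 1) * int (qbinom ?q n k)"
      by simp
    also have "\<dots> = int (qbinom ?q (Suc n) (Suc k)) * (int ?q ^ Suc k - 1)"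
      by (rule qbinom_absorb[OF CARD_field_ge_2, symmetric])
    finally have "int (card ?F) = int (qbinom ?q (Suc n) (Suc k))"
      using power_gt1[of "int ?q" k] CARD_field_ge_2[where 'k = 'k] by (simp del: qbinom.simps)
    then have "card ?F = qbinom ?q (Suc n) (Suc k)"
      by (simp only: of_nat_eq_iff)
    then show ?thesis using n by simp
  qed
qed

lemma card_subspaces_between:
  fixes X Y :: "(nat \<Rightarrow> 'k::{field,finite}) set"
  assumes "fv.subspace X" "fv.subspace Y" "X \<subseteq> Y" "finite Y"
  shows "card (subspaces_between X Y d)
    = (if fv.dim X \<le> d then qbinom CARD('k) (fv.dim Y - fv.dim X) (d - fv.dim X) else 0)"
proof (cases "fv.dim X \<le> d")
  case True
  then show ?thesis using card_subspaces_between_add[OF assms, of "d - fv.dim X"] by simp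
next
  case False
  then have "subspaces_between X Y d = {}"
    using dim_mono[OF assms(1)] assms finite_subset[of _ Y] by (fastforce simp: subspaces_between_def)
  then show ?thesis using False by simp
qed

text \<open>The rank-nullity theorem in terms of cardinalities: all fibres of a homomorphism are translates of its kernel.\<close>

lemma card_kernel_image:
  fixes f :: "'a::ab_group_add \<Rightarrow> 'b::ab_group_add"
  assumes "finite G" and f: "\<And>x y. f (x + y) = f x + f y"
    and G: "\<And>x y. x \<in> G \<Longrightarrow> y \<in> G \<Longrightarrow> x + y \<in> G" "\<And>x y. x \<in> G \<Longrightarrow> y \<in> G \<Longrightarrow> x - y \<in> G"
  shows "card G = card {x \<in> G. f x = 0} * card (f ` G)"
proof -
  have diff: "f (x - y) = f x - f y" for x y
    using f[of "x - y" y] by (simp add: algebra_simps)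
  have "card {x \<in> G. f x = y} = card {x \<in> G. f x = 0}" if y: "y \<in> f ` G" for y
  proof -
    obtain g where g: "g \<in> G" "y = f g" using y by blast
    have "bij_betw (\<lambda>x. x + g) {x \<in> G. f x = 0} {x \<in> G. f x = y}"
      by (rule bij_betw_byWitness[of _ "\<lambda>x. x - g"]) (use g G in \<open>auto simp: f diff\<close>)
    then show ?thesis using bij_betw_same_card by fastforce
  qed
  moreover have "card G = (\<Sum>y\<in>f ` G. card {x \<in> G. f x = y})"
    using sum.image_gen[OF assms(1), of "\<lambda>_. 1::nat" f] by simp
  ultimately show ?thesis by simp
qed

section \<open>Submodules of Kronecker modules\<close>

lemma linear_arrD:
  assumes "Vector_Spaces.linear fscale fscale f"
  shows "f (x + y) = f x + f y" "f (fscale c x) = fscale c (f x)" "f 0 = 0"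
proof -
  interpret module_hom fscale fscale f
    using assms by (simp add: Vector_Spaces.linear_def)
  show "f (x + y) = f x + f y" "f (fscale c x) = fscale c (f x)" "f 0 = 0"
    by (rule add scale zero)+
qed

lemma is_krep_arr:
  assumes "is_krep M"
  shows "arr_a M (x + y) = arr_a M x + arr_a M y" "arr_b M (x + y) = arr_b M x + arr_b M y"
    "arr_a M (fscale c x) = fscale c (arr_a M x)" "arr_b M (fscale c x) = fscale c (arr_b M x)"
    "arr_a M 0 = 0" "arr_b M 0 = 0"
  using assms linear_arrD by (auto simp: is_krep_def)

lemma is_krep_subspace:
  fixes M :: "'k::{field,finite} krep"
  assumes "is_krep M"
  shows "fv.subspace (sp1 M)" "fv.subspace (sp2 M)" "finite (sp1 M)" "finite (sp2 M)"
proof -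
  have "fv.subspace S \<and> finite S" if "fin_dim_subspace S" for S :: "(nat \<Rightarrow> 'k) set"
    using that finite_span fv.subspace_span by (metis fin_dim_subspace_def)
  then show "fv.subspace (sp1 M)" "fv.subspace (sp2 M)" "finite (sp1 M)" "finite (sp2 M)"
    using assms by (simp_all add: is_krep_def)
qed

lemma dim_zero: "fv.dim {0 :: nat \<Rightarrow> 'k::{field,finite}} = 0"
proof -
  have "CARD('k) ^ fv.dim {0 :: nat \<Rightarrow> 'k} = CARD('k) ^ 0"
    using card_subspace[of "{0 :: nat \<Rightarrow> 'k}"] by simp
  then show ?thesis by (simp only: CARD_power_eq_iff)
qed

text \<open>The second space of the smallest submodule of \<open>M\<close> with first space \<open>U\<close>.\<close>

definition gen :: "'k::field krep \<Rightarrow> (nat \<Rightarrow> 'k) set \<Rightarrow> (nat \<Rightarrow> 'k) set" where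
  "gen M U = (\<lambda>(u, w). arr_a M u + arr_b M w) ` (U \<times> U)"

text \<open>The first space of the largest submodule of \<open>M\<close> with second space \<open>W\<close>.\<close>

definition pre :: "'k::field krep \<Rightarrow> (nat \<Rightarrow> 'k) set \<Rightarrow> (nat \<Rightarrow> 'k) set" where
  "pre M W = {v \<in> sp1 M. arr_a M v \<in> W \<and> arr_b M v \<in> W}"

lemma subspace_gen:
  assumes "is_krep M" "fv.subspace U"
  shows "fv.subspace (gen M U)"
proof (rule fv.subspaceI)
  note U = assms(2) fv.subspace_0 fv.subspace_add fv.subspace_scale
  show "0 \<in> gen M U"
    unfolding gen_def using U is_krep_arr[OF assms(1)] by (intro image_eqI[of _ _ "(0, 0)"]) auto
  fix x y c assume "x \<in> gen M U"
  then obtain u w where x: "x = arr_a M u + arr_b M w" "u \<in> U" "w \<in> U" unfolding gen_def by auto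
  show "fscale c x \<in> gen M U"
    unfolding gen_def using U x is_krep_arr[OF assms(1)]
    by (intro image_eqI[of _ _ "(fscale c u, fscale c w)"]) (auto simp: fv.scale_right_distrib)
  assume "y \<in> gen M U"
  then obtain u' w' where y: "y = arr_a M u' + arr_b M w'" "u' \<in> U" "w' \<in> U" unfolding gen_def by auto
  show "x + y \<in> gen M U"
    unfolding gen_def using U x y is_krep_arr[OF assms(1)]
    by (intro image_eqI[of _ _ "(u + u', w + w')"]) (auto simp: algebra_simps)
qed

lemma subspace_pre:
  fixes M :: "'k::{field,finite} krep"
  assumes "is_krep M" "fv.subspace W"
  shows "fv.subspace (pre M W)"
  using assms(2) is_krep_subspace(1)[OF assms(1)]
  by (auto simp: fv.subspace_def pre_def is_krep_arr[OF assms(1)])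

lemma gen_subset_iff:
  assumes "is_krep M" "fv.subspace U" "fv.subspace W"
  shows "gen M U \<subseteq> W \<longleftrightarrow> arr_a M ` U \<subseteq> W \<and> arr_b M ` U \<subseteq> W"
proof
  assume g: "gen M U \<subseteq> W"
  have "arr_a M u \<in> gen M U" "arr_b M u \<in> gen M U" if "u \<in> U" for u
    unfolding gen_def using that fv.subspace_0[OF assms(2)] is_krep_arr[OF assms(1)]
    by (auto intro: image_eqI[of _ _ "(u, 0)"] image_eqI[of _ _ "(0, u)"])
  then show "arr_a M ` U \<subseteq> W \<and> arr_b M ` U \<subseteq> W" using g by auto
next
  assume "arr_a M ` U \<subseteq> W \<and> arr_b M ` U \<subseteq> W"
  then show "gen M U \<subseteq> W"
    unfolding gen_def by (auto intro!: fv.subspace_add[OF assms(3)])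
qed

lemma gen_subset_sp2:
  fixes M :: "'k::{field,finite} krep"
  assumes "is_krep M" "fv.subspace U" "U \<subseteq> sp1 M"
  shows "gen M U \<subseteq> sp2 M"
  using gen_subset_iff[OF assms(1,2) is_krep_subspace(2)[OF assms(1)]] assms
  by (auto simp: is_krep_def)

text \<open>A submodule with first space \<open>U\<close> amounts to a subspace of \<open>M\<^sub>2\<close> that contains \<open>gen M U\<close>.\<close>

lemma card_Gr_gen:
  fixes M :: "'k::{field,finite} krep"
  assumes M: "is_krep M"
  shows "card (Gr (a, b) M) = (\<Sum>U\<in>subspaces_between {0} (sp1 M) a.
     if fv.dim (gen M U) \<le> b
     then qbinom CARD('k) (fv.dim (sp2 M) - fv.dim (gen M U)) (b - fv.dim (gen M U)) else 0)"
proof -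
  note sub = is_krep_subspace[OF M]
  have "Gr (a, b) M = (SIGMA U:subspaces_between {0} (sp1 M) a. subspaces_between (gen M U) (sp2 M) b)"
  proof (rule set_eqI, clarify)
    fix U W
    show "(U, W) \<in> Gr (a, b) M \<longleftrightarrow> (U, W) \<in> (SIGMA U:subspaces_between {0} (sp1 M) a. subspaces_between (gen M U) (sp2 M) b)"
    proof (cases "fv.subspace U \<and> fv.subspace W")
      case True
      then show ?thesis
        using gen_subset_iff[OF M, of U W] fv.subspace_0[of U]
        by (simp add: Gr_def submods_def subspaces_between_def conj_ac)
    qed (auto simp: Gr_def submods_def subspaces_between_def)
  qed
  also have "card \<dots> = (\<Sum>U\<in>subspaces_between {0} (sp1 M) a. card (subspaces_between (gen M U) (sp2 M) b))"
    using sub by (intro card_SigmaI) (auto simp: finite_subspaces_between)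
  also have "\<dots> = (\<Sum>U\<in>subspaces_between {0} (sp1 M) a.
     if fv.dim (gen M U) \<le> b
     then qbinom CARD('k) (fv.dim (sp2 M) - fv.dim (gen M U)) (b - fv.dim (gen M U)) else 0)"
    using sub gen_subset_sp2[OF M] subspace_gen[OF M]
    by (intro sum.cong card_subspaces_between) (auto simp: subspaces_between_def)
  finally show ?thesis .
qed

text \<open>A submodule with second space \<open>W\<close> amounts to a subspace of \<open>pre M W\<close>.\<close>

lemma card_Gr_pre:
  fixes M :: "'k::{field,finite} krep"
  assumes M: "is_krep M"
  shows "card (Gr (a, b) M) = (\<Sum>W\<in>subspaces_between {0} (sp2 M) b. qbinom CARD('k) (fv.dim (pre M W)) a)"
proof -
  note sub = is_krep_subspace[OF M]
  have "Gr (a, b) M = prod.swap ` (SIGMA W:subspaces_between {0} (sp2 M) b. subspaces_between {0} (pre M W) a)"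
    by (auto simp: Gr_def submods_def subspaces_between_def pre_def fv.subspace_0 image_iff image_subset_iff)
  then have "card (Gr (a, b) M) = card (SIGMA W:subspaces_between {0} (sp2 M) b. subspaces_between {0} (pre M W) a)"
    by (simp add: card_image)
  also have "\<dots> = (\<Sum>W\<in>subspaces_between {0} (sp2 M) b. card (subspaces_between {0} (pre M W) a))"
    using sub by (intro card_SigmaI) (auto simp: finite_subspaces_between pre_def)
  also have "\<dots> = (\<Sum>W\<in>subspaces_between {0} (sp2 M) b. qbinom CARD('k) (fv.dim (pre M W)) a)"
  proof (rule sum.cong[OF refl])
    fix W assume "W \<in> subspaces_between {0} (sp2 M) b"
    then have W: "fv.subspace (pre M W)" by (auto simp: subspaces_between_def intro: subspace_pre[OF M])
    have "finite (pre M W)" using sub by (auto simp: pre_def)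
    then show "card (subspaces_between {0} (pre M W) a) = qbinom CARD('k) (fv.dim (pre M W)) a"
      using card_subspaces_between[of "{0}" "pre M W" a] W by (simp add: fv.subspace_0 dim_zero)
  qed
  finally show ?thesis .
qed

section \<open>Reflections and submodule counts\<close>

text \<open>The relation that both reflections have in common: it holds if \<open>B\<close> is a sink reflection of \<open>A\<close>,
  and if \<open>A\<close> is a source reflection of \<open>B\<close> and the arrows of \<open>B\<close> have no common kernel. For
  every \<open>W\<close> the space \<open>pre B W\<close> is then isomorphic to the kernel, and \<open>gen A W\<close> is the image, of the
  map \<open>W \<oplus> W \<rightarrow> A\<^sub>2\<close> given by the two arrows of \<open>A\<close>.\<close>

definition linked :: "'k::{field,finite} krep \<Rightarrow> 'k krep \<Rightarrow> bool" where
  "linked A B \<longleftrightarrow> is_krep A \<and> is_krep B \<and> sp1 A = sp2 B \<and>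
     (\<forall>W. fv.subspace W \<longrightarrow> W \<subseteq> sp1 A \<longrightarrow> fv.dim (pre B W) + fv.dim (gen A W) = 2 * fv.dim W)"

lemma card_gen:
  fixes M :: "'k::{field,finite} krep"
  assumes M: "is_krep M" and W: "fv.subspace W" "finite W"
  shows "card W * card W = card {(u, w) \<in> W \<times> W. arr_a M u + arr_b M w = 0} * card (gen M W)"
proof -
  have "card (W \<times> W) = card {x \<in> W \<times> W. (\<lambda>(u, w). arr_a M u + arr_b M w) x = 0} * card (gen M W)"
    unfolding gen_def
    by (rule card_kernel_image)
      (use W in \<open>auto simp: is_krep_arr[OF M] algebra_simps intro: fv.subspace_add fv.subspace_diff\<close>)
  moreover have "{x \<in> W \<times> W. (\<lambda>(u, w). arr_a M u + arr_b M w) x = 0} = {(u, w) \<in> W \<times> W. arr_a M u + arr_b M w = 0}"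
    by auto
  ultimately show ?thesis by (simp add: card_cartesian_product)
qed

lemma linkedI:
  fixes A B :: "'k::{field,finite} krep"
  assumes AB: "is_krep A" "is_krep B" "sp1 A = sp2 B"
    and inj: "inj_on (\<lambda>v. (arr_a B v, arr_b B v)) (sp1 B)"
    and img: "(\<lambda>v. (arr_a B v, arr_b B v)) ` sp1 B = {(u, w) \<in> sp1 A \<times> sp1 A. arr_a A u + arr_b A w = 0}"
  shows "linked A B"
  unfolding linked_def
proof (intro conjI allI impI AB)
  fix W :: "(nat \<Rightarrow> 'k) set" assume W: "fv.subspace W" "W \<subseteq> sp1 A"
  note fin = finite_subset[OF W(2) is_krep_subspace(3)[OF AB(1)]]
  have "(\<lambda>v. (arr_a B v, arr_b B v)) ` pre B W = {(u, w) \<in> W \<times> W. arr_a A u + arr_b A w = 0}"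
  proof -
    have "(\<lambda>v. (arr_a B v, arr_b B v)) ` pre B W = (\<lambda>v. (arr_a B v, arr_b B v)) ` sp1 B \<inter> W \<times> W"
      by (auto simp: pre_def)
    then show ?thesis unfolding img using W(2) by auto
  qed
  moreover have "card ((\<lambda>v. (arr_a B v, arr_b B v)) ` pre B W) = card (pre B W)"
    by (rule card_image, rule inj_on_subset[OF inj]) (auto simp: pre_def)
  ultimately have "card (pre B W) = card {(u, w) \<in> W \<times> W. arr_a A u + arr_b A w = 0}"
    by (simp only:)
  then have "card (pre B W) * card (gen A W) = card W * card W"
    using card_gen[OF AB(1) W(1) fin] by simp
  moreover have "finite (pre B W)" "finite (gen A W)"
    using fin is_krep_subspace[OF AB(2)] by (auto simp: pre_def gen_def)
  ultimately have "CARD('k) ^ (fv.dim (pre B W) + fv.dim (gen A W)) = CARD('k) ^ (fv.dim W + fv.dim W)"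
    using W fin subspace_pre[OF AB(2)] subspace_gen[OF AB(1)]
    by (simp only: power_add card_subspace)
  then show "fv.dim (pre B W) + fv.dim (gen A W) = 2 * fv.dim W"
    by (simp only: CARD_power_eq_iff)
qed

lemma sink_reflection_linked:
  fixes M N :: "'k::{field,finite} krep"
  assumes "is_krep M" "sink_reflection M N"
  shows "linked M N"
  using assms by (intro linkedI) (auto simp: sink_reflection_def bij_betw_def)

text \<open>The kernel of \<open>M\<^sub>1 \<oplus> M\<^sub>1 \<rightarrow> M\<^sub>2\<close> has at least the expected dimension. Dually for the cokernel in \<open>source_reflection_dim\<close>.\<close>

lemma sink_reflection_dim:
  fixes M N :: "'k::{field,finite} krep"
  assumes M: "is_krep M" and MN: "sink_reflection M N"
  shows "2 * fv.dim (sp1 M) \<le> fv.dim (sp1 N) + fv.dim (sp2 M)"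
proof -
  have L: "linked M N" using assms by (rule sink_reflection_linked)
  note sub = is_krep_subspace[OF M]
  have "is_krep N" "sp2 N = sp1 M" using L by (auto simp: linked_def)
  then have "pre N (sp1 M) = sp1 N" by (auto simp: pre_def is_krep_def)
  then have "fv.dim (sp1 N) + fv.dim (gen M (sp1 M)) = 2 * fv.dim (sp1 M)"
    using L sub by (auto simp: linked_def)
  moreover have "fv.dim (gen M (sp1 M)) \<le> fv.dim (sp2 M)"
    using sub gen_subset_sp2[OF M] subspace_gen[OF M] by (intro dim_mono) auto
  ultimately show ?thesis by simp
qed

lemma source_reflection_card:
  fixes M N :: "'k::{field,finite} krep"
  assumes M: "is_krep M" and MN: "source_reflection M N"
  shows "card ((\<lambda>v. (arr_a M v, arr_b M v)) ` sp1 M) * CARD('k) ^ fv.dim (sp2 N)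
    = CARD('k) ^ (2 * fv.dim (sp2 M))"
proof -
  have N: "is_krep N" "sp1 N = sp2 M" "gen N (sp1 N) = sp2 N"
    "{(u, w) \<in> sp1 N \<times> sp1 N. arr_a N u + arr_b N w = 0} = (\<lambda>v. (arr_a M v, arr_b M v)) ` sp1 M"
    using MN unfolding source_reflection_def gen_def by blast+
  note sub = is_krep_subspace[OF M] is_krep_subspace[OF N(1)]
  have "card ((\<lambda>v. (arr_a M v, arr_b M v)) ` sp1 M) * card (sp2 N) = card (sp2 M) * card (sp2 M)"
    using card_gen[OF N(1) sub(5,7)] unfolding N(3,4) unfolding N(2) by simp
  then show ?thesis using sub by (simp add: card_subspace mult_2 power_add)
qed

lemma source_reflection_dim:
  fixes M N :: "'k::{field,finite} krep"
  assumes M: "is_krep M" and MN: "source_reflection M N"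
  shows "2 * fv.dim (sp2 M) \<le> fv.dim (sp1 M) + fv.dim (sp2 N)"
proof -
  note sub = is_krep_subspace[OF M]
  have "CARD('k) ^ (2 * fv.dim (sp2 M)) \<le> card (sp1 M) * CARD('k) ^ fv.dim (sp2 N)"
    unfolding source_reflection_card[OF assms, symmetric] using sub by (intro mult_right_mono card_image_le) auto
  then have "CARD('k) ^ (2 * fv.dim (sp2 M)) \<le> CARD('k) ^ (fv.dim (sp1 M) + fv.dim (sp2 N))"
    using sub by (simp add: card_subspace power_add)
  then show ?thesis
    using CARD_field_ge_2[where 'k = 'k] by (simp add: power_increasing_iff)
qed

text \<open>The dimension condition says that the two arrows of \<open>M\<close> have no common kernel. If they had one,
  it would be lost under the reflection.\<close>

lemma source_reflection_linked:
  fixes M N :: "'k::{field,finite} krep"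
  assumes M: "is_krep M" and MN: "source_reflection M N"
    and dim: "2 * fv.dim (sp2 M) = fv.dim (sp1 M) + fv.dim (sp2 N)"
  shows "linked N M"
proof (rule linkedI)
  note sub = is_krep_subspace[OF M]
  have "card ((\<lambda>v. (arr_a M v, arr_b M v)) ` sp1 M) * CARD('k) ^ fv.dim (sp2 N)
     = card (sp1 M) * CARD('k) ^ fv.dim (sp2 N)"
    unfolding source_reflection_card[OF assms(1,2)] dim using sub by (simp add: card_subspace power_add)
  then have "card ((\<lambda>v. (arr_a M v, arr_b M v)) ` sp1 M) = card (sp1 M)"
    by simp
  then show "inj_on (\<lambda>v. (arr_a M v, arr_b M v)) (sp1 M)"
    by (rule eq_card_imp_inj_on[OF sub(3)])
  show "(\<lambda>v. (arr_a M v, arr_b M v)) ` sp1 M = {(u, w) \<in> sp1 N \<times> sp1 N. arr_a N u + arr_b N w = 0}"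
    using MN unfolding source_reflection_def by (elim conjE) (rule sym)
qed (use M MN in \<open>simp_all add: source_reflection_def\<close>)

text \<open>The step from \<open>V(-(t-1))\<close> to \<open>V(-t)\<close>: the counts for \<open>B\<close> are the hypothesis of the transfer
  lemma for \<open>h W = dim (pre B W)\<close>, and the counts for \<open>A\<close> are its conclusion.\<close>

lemma card_Gr_linked_left:
  fixes A B :: "'k::{field,finite} krep"
  assumes L: "linked A B" and t: "fv.dim (sp1 A) = t" and d: "fv.dim (sp2 A) = t + 1" and "1 \<le> t"
    and B: "\<And>a b. b \<le> t \<Longrightarrow> card (Gr (a, b) B) = qbinom CARD('k) (t - a) (b - a) * qbinom CARD('k) (b - 1) a"
    and w: "w \<le> t"
  shows "card (Gr (w, b) A) = qbinom CARD('k) (t + 1 - w) (b - w) * qbinom CARD('k) (b - 1) w"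
proof -
  have A: "is_krep A" "is_krep B" "sp1 A = sp2 B" using L by (auto simp: linked_def)
  let ?S = "subspaces_between {0} (sp1 A) w"
  have "card (Gr (w, b) A) = (\<Sum>U\<in>?S. if 2 * w - fv.dim (pre B U) \<le> b
     then qbinom CARD('k) (t + 1 + fv.dim (pre B U) - 2 * w) (b + fv.dim (pre B U) - 2 * w) else 0)"
    unfolding card_Gr_gen[OF A(1)]
  proof (rule sum.cong[OF refl])
    fix U assume U: "U \<in> ?S"
    then have e: "fv.dim (pre B U) + fv.dim (gen A U) = 2 * w"
      using L by (auto simp: linked_def subspaces_between_def)
    then have "fv.dim (gen A U) = 2 * w - fv.dim (pre B U)" by simp
    moreover have "fv.dim (gen A U) \<le> t + 1"
      using U dim_mono[OF subspace_gen[OF A(1)], of U "sp2 A"] is_krep_subspace[OF A(1)] gen_subset_sp2[OF A(1)] d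
      by (auto simp: subspaces_between_def)
    ultimately show "(if fv.dim (gen A U) \<le> b
         then qbinom CARD('k) (fv.dim (sp2 A) - fv.dim (gen A U)) (b - fv.dim (gen A U)) else 0) =
       (if 2 * w - fv.dim (pre B U) \<le> b
        then qbinom CARD('k) (t + 1 + fv.dim (pre B U) - 2 * w) (b + fv.dim (pre B U) - 2 * w) else 0)"
      using e d by (auto intro!: arg_cong2[where f = "qbinom CARD('k)"])
  qed
  also have "\<dots> = qbinom CARD('k) (t + 1 - w) (b - w) * qbinom CARD('k) (b - 1) w"
  proof (rule qbinom_sum_transfer[OF CARD_field_ge_2 w])
    show "finite ?S" using is_krep_subspace[OF A(1)] by (simp add: finite_subspaces_between)
    show "(\<Sum>x\<in>?S. qbinom CARD('k) (fv.dim (pre B x)) a) = qbinom CARD('k) (t - a) (w - a) * qbinom CARD('k) (w - 1) a" for a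
      using card_Gr_pre[OF A(2), of a w] B[of w a] w A(3) by simp
  qed
  finally show ?thesis .
qed

text \<open>The step from \<open>V(t+2)\<close> to \<open>V(t+3)\<close>, now from \<open>A\<close> to \<open>B\<close>. It is the dual of the previous one, and the same
  transfer lemma applies to the dual numbers: the codimension \<open>t - b\<close> replaces the dimension of the
  subspaces \<open>W\<close>, and \<open>h W\<close> is the codimension of \<open>gen A W\<close>.\<close>

lemma card_Gr_linked_right:
  fixes A B :: "'k::{field,finite} krep"
  assumes L: "linked A B" and t: "fv.dim (sp1 A) = t" and d: "fv.dim (sp2 A) = t - 1" and t1: "1 \<le> t"
    and A': "\<And>a b. a \<le> t \<Longrightarrow> b \<le> t - 1 \<Longrightarrow>
      card (Gr (a, b) A) = qbinom CARD('k) (b + 1) a * qbinom CARD('k) (t - 1 - a) (t - 1 - b)"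
    and b: "b \<le> t" and a: "a \<le> t + 1"
  shows "card (Gr (a, b) B) = qbinom CARD('k) (b + 1) a * qbinom CARD('k) (t - a) (t - b)"
proof -
  have A: "is_krep A" "is_krep B" "sp1 A = sp2 B" using L by (auto simp: linked_def)
  let ?S = "subspaces_between {0} (sp1 A) b" and ?w = "t - b" and ?b = "t + 1 - a"
  let ?h = "\<lambda>W. t - 1 - fv.dim (gen A W)"
  have gen: "fv.dim (pre B W) + fv.dim (gen A W) = 2 * b" "fv.dim (gen A W) \<le> t - 1" if "W \<in> ?S" for W
  proof -
    show "fv.dim (pre B W) + fv.dim (gen A W) = 2 * b"
      using that L by (auto simp: linked_def subspaces_between_def)
    show "fv.dim (gen A W) \<le> t - 1"
      using that dim_mono[OF subspace_gen[OF A(1)], of W "sp2 A"] is_krep_subspace[OF A(1)] gen_subset_sp2[OF A(1)] d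
      by (auto simp: subspaces_between_def)
  qed
  have "card (Gr (a, b) B) = (\<Sum>W\<in>?S. qbinom CARD('k) (fv.dim (pre B W)) a)"
    unfolding card_Gr_pre[OF A(2)] A(3) ..
  also have "\<dots> = (\<Sum>W\<in>?S. if 2 * ?w - ?h W \<le> ?b then qbinom CARD('k) (t + 1 + ?h W - 2 * ?w) (?b + ?h W - 2 * ?w) else 0)"
  proof (rule sum.cong[OF refl])
    fix W assume W: "W \<in> ?S"
    note g = gen[OF W]
    have 1: "fv.dim (pre B W) = t + 1 + ?h W - 2 * ?w" using g b t1 by linarith
    have 2: "2 * ?w - ?h W \<le> ?b \<longleftrightarrow> a \<le> fv.dim (pre B W)" using g b a t1 by linarith
    have 3: "?b + ?h W - 2 * ?w = fv.dim (pre B W) - a" if "a \<le> fv.dim (pre B W)" using g b a t1 that by linarith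
    show "qbinom CARD('k) (fv.dim (pre B W)) a = (if 2 * ?w - ?h W \<le> ?b then qbinom CARD('k) (t + 1 + ?h W - 2 * ?w) (?b + ?h W - 2 * ?w) else 0)"
      unfolding 2 1[symmetric]
      by (cases "a \<le> fv.dim (pre B W)")
        (simp_all only: 3 if_True if_False qbinom_sym[OF CARD_field_ge_2] qbinom_eq_0 not_le simp_thms, simp add: qbinom_eq_0)
  qed
  also have "\<dots> = qbinom CARD('k) (t + 1 - ?w) (?b - ?w) * qbinom CARD('k) (?b - 1) ?w"
  proof (rule qbinom_sum_transfer[OF CARD_field_ge_2])
    show "?w \<le> t" by simp
    show "finite ?S" using is_krep_subspace[OF A(1)] by (simp add: finite_subspaces_between)
    fix i
    show "(\<Sum>x\<in>?S. qbinom CARD('k) (?h x) i) = qbinom CARD('k) (t - i) (?w - i) * qbinom CARD('k) (?w - 1) i"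
    proof (cases "i \<le> t - 1")
      case False
      then have "qbinom CARD('k) (?h x) i = 0" for x using t1 by (intro qbinom_eq_0) linarith
      moreover have "qbinom CARD('k) (?w - 1) i = 0" using False t1 by (intro qbinom_eq_0) linarith
      ultimately show ?thesis by simp
    next
      case True
      define j where "j = t - 1 - i"
      have j: "j \<le> t - 1" "i = t - 1 - j" using True by (auto simp: j_def)
      have "(\<Sum>x\<in>?S. qbinom CARD('k) (?h x) i) = card (Gr (b, j) A)"
        unfolding card_Gr_gen[OF A(1)]
      proof (rule sum.cong[OF refl])
        fix W assume W: "W \<in> ?S"
        note g = gen(2)[OF W]
        have 1: "fv.dim (gen A W) \<le> j \<longleftrightarrow> i \<le> ?h W" using g j t1 by linarith
        have 2: "j - fv.dim (gen A W) = ?h W - i" if "i \<le> ?h W" using g j t1 that by linarith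
        show "qbinom CARD('k) (?h W) i = (if fv.dim (gen A W) \<le> j
           then qbinom CARD('k) (fv.dim (sp2 A) - fv.dim (gen A W)) (j - fv.dim (gen A W)) else 0)"
          unfolding 1 d
          by (cases "i \<le> ?h W")
            (simp_all only: 2 if_True if_False qbinom_sym[OF CARD_field_ge_2] qbinom_eq_0 not_le simp_thms, simp add: qbinom_eq_0)
      qed
      also have "\<dots> = qbinom CARD('k) (j + 1) b * qbinom CARD('k) (t - 1 - b) i"
        using A'[OF b j(1)] j(2) by simp
      also have "qbinom CARD('k) (j + 1) b * qbinom CARD('k) (t - 1 - b) i = qbinom CARD('k) (t - i) (?w - i) * qbinom CARD('k) (?w - 1) i"
      proof (cases "b \<le> j + 1")
        case True
        have "j + 1 - b = ?w - i" "t - i = j + 1" using j t1 by auto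
        then show ?thesis using qbinom_sym[OF CARD_field_ge_2[where 'k = 'k] True] by (simp add: diff_right_commute)
      next
        case False
        then have "qbinom CARD('k) (j + 1) b = 0" "qbinom CARD('k) (?w - 1) i = 0"
          using j t1 b by (auto intro!: qbinom_eq_0)
        then show ?thesis by simp
      qed
      finally show ?thesis .
    qed
  qed
  also have "\<dots> = qbinom CARD('k) (b + 1) a * qbinom CARD('k) (t - a) (t - b)"
  proof (cases "a \<le> b + 1")
    case True
    have "t + 1 - ?w = b + 1" "?b - ?w = b + 1 - a" "?b - 1 = t - a" using b a True by auto
    then show ?thesis using qbinom_sym[OF CARD_field_ge_2[where 'k = 'k] True] by simp
  next
    case False
    then have "qbinom CARD('k) (b + 1) a = 0" "qbinom CARD('k) (?b - 1) ?w = 0"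
      using a b by (auto intro!: qbinom_eq_0)
    then show ?thesis by simp
  qed
  finally show ?thesis .
qed

section \<open>Submodule counts of preprojective and preinjective modules\<close>

lemma subspaces_between_eq_empty:
  fixes Y :: "(nat \<Rightarrow> 'k::{field,finite}) set"
  assumes "fv.subspace Y" "finite Y" "fv.dim Y < d"
  shows "subspaces_between X Y d = {}"
proof -
  have "W \<notin> subspaces_between X Y d" for W
    using dim_mono[of W Y] assms by (auto simp: subspaces_between_def)
  then show ?thesis by blast
qed

lemma preprojective_chain:
  assumes "preprojective M"
  obtains Z where "sink_reflection\<^sup>*\<^sup>* M Z" "zero_krep Z"
proof -
  obtain Z where "ar_translate\<^sup>*\<^sup>* M Z" "zero_krep Z"
    using assms by (auto simp: preprojective_def)
  moreover have "sink_reflection\<^sup>*\<^sup>* A B" if "ar_translate\<^sup>*\<^sup>* A B" for A B :: "'a krep"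
    using that by induction (auto simp: ar_translate_def intro: rtranclp.rtrancl_into_rtrancl)
  ultimately show thesis using that by blast
qed

lemma preinjective_chain:
  assumes "preinjective M"
  obtains Z where "source_reflection\<^sup>*\<^sup>* M Z" "zero_krep Z"
proof -
  obtain Z where "ar_translate_inv\<^sup>*\<^sup>* M Z" "zero_krep Z"
    using assms by (auto simp: preinjective_def)
  moreover have "source_reflection\<^sup>*\<^sup>* A B" if "ar_translate_inv\<^sup>*\<^sup>* A B" for A B :: "'a krep"
    using that by induction (auto simp: ar_translate_inv_def intro: rtranclp.rtrancl_into_rtrancl)
  ultimately show thesis using that by blast
qed

text \<open>If \<open>dim M\<^sub>1 \<ge> dim M\<^sub>2\<close> and \<open>M\<^sub>1\<close> is not zero, then by \<open>sink_reflection_dim\<close> every sink reflection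
  has these two properties again, so repeated reflection never reaches zero.\<close>

lemma sink_chain_dim:
  fixes M Z :: "'k::{field,finite} krep"
  assumes "sink_reflection\<^sup>*\<^sup>* M Z" "zero_krep Z" "is_krep M"
  shows "fv.dim (sp1 M) = 0 \<or> fv.dim (sp1 M) < fv.dim (sp2 M)"
  using assms
proof (induction rule: converse_rtranclp_induct)
  case base
  then show ?case by (simp add: zero_krep_def dim_zero)
next
  case (step M N)
  then have "is_krep N" "sp2 N = sp1 M" by (auto simp: sink_reflection_def)
  then show ?case using step sink_reflection_dim[of M N] by auto
qed

lemma source_chain_dim:
  fixes M Z :: "'k::{field,finite} krep"
  assumes "source_reflection\<^sup>*\<^sup>* M Z" "zero_krep Z" "is_krep M"
  shows "fv.dim (sp2 M) = 0 \<or> fv.dim (sp2 M) < fv.dim (sp1 M)"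
  using assms
proof (induction rule: converse_rtranclp_induct)
  case base
  then show ?case by (simp add: zero_krep_def dim_zero)
next
  case (step M N)
  then have "is_krep N" "sp1 N = sp2 M" by (auto simp: source_reflection_def)
  then show ?case using step source_reflection_dim[of M N] by auto
qed

text \<open>For a sink reflection \<open>N\<close> of a module with dimension vector \<open>(l+1, l+2)\<close>, \<open>sink_reflection_dim\<close>
  gives \<open>dim N\<^sub>1 \<ge> l\<close> and \<open>sink_chain_dim\<close> gives \<open>dim N\<^sub>1 \<le> l\<close>. So the dimension vector of \<open>N\<close> is
  \<open>(l, l+1)\<close>, and the induction hypothesis applies.\<close>

lemma card_Gr_sink_chain:
  fixes M Z :: "'k::{field,finite} krep"
  assumes "sink_reflection\<^sup>*\<^sup>* M Z" "zero_krep Z" "is_krep M" "dimvec M = (l, l + 1)" "b \<le> l + 1"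
  shows "card (Gr (a, b) M) = qbinom CARD('k) (l + 1 - a) (b - a) * qbinom CARD('k) (b - 1) a"
  using assms
proof (induction l arbitrary: M a b)
  case 0
  note M = "0.prems"(3)
  have d: "fv.dim (sp1 M) = 0" "fv.dim (sp2 M) = 1" using 0 by (auto simp: dimvec_def)
  have "fv.dim (pre M W) = 0" if "W \<in> subspaces_between {0} (sp2 M) b" for W
    using dim_mono[of "pre M W" "sp1 M"] that subspace_pre[OF M] is_krep_subspace[OF M] d
    by (auto simp: subspaces_between_def pre_def)
  then have "card (Gr (a, b) M) = card (subspaces_between {0} (sp2 M) b) * qbinom CARD('k) 0 a"
    unfolding card_Gr_pre[OF M] by simp
  also have "card (subspaces_between {0} (sp2 M) b) = qbinom CARD('k) 1 b"
    using is_krep_subspace[OF M] d by (simp add: card_subspaces_between dim_zero fv.subspace_0)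
  finally show ?case using "0.prems"(5) by (cases a) auto
next
  case (Suc l)
  note M = Suc.prems(3)
  have d: "fv.dim (sp1 M) = Suc l" "fv.dim (sp2 M) = Suc l + 1" using Suc.prems by (auto simp: dimvec_def)
  then have "M \<noteq> Z" using Suc.prems(2) by (auto simp: zero_krep_def dim_zero)
  then obtain N where N: "sink_reflection M N" "sink_reflection\<^sup>*\<^sup>* N Z"
    using Suc.prems(1) by (auto elim: converse_rtranclpE)
  have N': "is_krep N" "sp2 N = sp1 M" using N by (auto simp: sink_reflection_def)
  have "fv.dim (sp1 N) = 0 \<or> fv.dim (sp1 N) < fv.dim (sp2 N)"
    using N N' Suc.prems(2) by (intro sink_chain_dim)
  then have dN: "dimvec N = (l, l + 1)"
    using sink_reflection_dim[OF M N(1)] N' d by (auto simp: dimvec_def)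
  show ?case
  proof (cases "a \<le> Suc l")
    case True
    show ?thesis
      using card_Gr_linked_left[OF sink_reflection_linked[OF M N(1)] d _ _ True, of b]
        Suc.IH[OF N(2) Suc.prems(2) N'(1) dN] by simp
  next
    case False
    then have "card (Gr (a, b) M) = 0"
      unfolding card_Gr_gen[OF M] using is_krep_subspace[OF M] d by (simp add: subspaces_between_eq_empty)
    moreover have "qbinom CARD('k) (b - 1) a = 0" using False Suc.prems by (intro qbinom_eq_0) auto
    ultimately show ?thesis by simp
  qed
qed

text \<open>Dual to \<open>card_Gr_sink_chain\<close>.\<close>

lemma card_Gr_source_chain:
  fixes M Z :: "'k::{field,finite} krep"
  assumes "source_reflection\<^sup>*\<^sup>* M Z" "zero_krep Z" "is_krep M" "dimvec M = (l + 1, l)" "a \<le> l + 1" "b \<le> l"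
  shows "card (Gr (a, b) M) = qbinom CARD('k) (b + 1) a * qbinom CARD('k) (l - a) (l - b)"
  using assms
proof (induction l arbitrary: M a b)
  case 0
  note M = "0.prems"(3)
  have d: "fv.dim (sp1 M) = 1" "fv.dim (sp2 M) = 0" using 0 by (auto simp: dimvec_def)
  have "fv.dim (gen M U) = 0" if "U \<in> subspaces_between {0} (sp1 M) a" for U
    using dim_mono[of "gen M U" "sp2 M"] that subspace_gen[OF M] gen_subset_sp2[OF M] is_krep_subspace[OF M] d
    by (auto simp: subspaces_between_def)
  then have "card (Gr (a, b) M) = card (subspaces_between {0} (sp1 M) a) * qbinom CARD('k) 0 b"
    unfolding card_Gr_gen[OF M] using d by simp
  also have "card (subspaces_between {0} (sp1 M) a) = qbinom CARD('k) 1 a"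
    using is_krep_subspace[OF M] d by (simp add: card_subspaces_between dim_zero fv.subspace_0)
  finally show ?case using "0.prems"(6) by simp
next
  case (Suc l)
  note M = Suc.prems(3)
  have d: "fv.dim (sp1 M) = Suc l + 1" "fv.dim (sp2 M) = Suc l" using Suc.prems by (auto simp: dimvec_def)
  then have "M \<noteq> Z" using Suc.prems(2) by (auto simp: zero_krep_def dim_zero)
  then obtain N where N: "source_reflection M N" "source_reflection\<^sup>*\<^sup>* N Z"
    using Suc.prems(1) by (auto elim: converse_rtranclpE)
  have N': "is_krep N" "sp1 N = sp2 M" using N by (auto simp: source_reflection_def)
  have "fv.dim (sp2 N) = 0 \<or> fv.dim (sp2 N) < fv.dim (sp1 N)"
    using N N' Suc.prems(2) by (intro source_chain_dim)
  then have dN: "dimvec N = (l + 1, l)"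
    using source_reflection_dim[OF M N(1)] N' d by (auto simp: dimvec_def)
  have L: "linked N M"
    using dN d by (intro source_reflection_linked[OF M N(1)]) (auto simp: dimvec_def)
  show ?case
    using Suc.IH[OF N(2) Suc.prems(2) N'(1) dN] dN Suc.prems(5,6)
    by (intro card_Gr_linked_right[OF L]) (auto simp: dimvec_def)
qed

section \<open>The coefficients of the cluster variables\<close>

lemma of_nat_CARD_power: "(of_nat (CARD('k) ^ i) :: 'k::{field,finite} qcoeff) = qhalf (2 * int i)"
  by (induction i) (simp_all add: qhalf_2[symmetric] distrib_left qhalf_add mult.commute)

text \<open>The factor \<open>q\<^sup>-\<^sup>k\<^sup>(\<^sup>n\<^sup>-\<^sup>k\<^sup>)\<^sup>/\<^sup>2\<close> makes the Gaussian binomial invariant under \<open>q \<mapsto> 1/q\<close>. The truncation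
  of \<open>n\<close> implements the convention that for negative \<open>n\<close> the value is 1 at \<open>k = 0\<close> and 0 otherwise.\<close>

definition symbinom :: "int \<Rightarrow> int \<Rightarrow> 'k::{field,finite} qcoeff" where
  "symbinom n k = (if k < 0 then 0 else qhalf (- (k * (n - k))) * of_nat (qbinom CARD('k) (nat n) (nat k)))"

lemma symbinom_neg [simp]: "k < 0 \<Longrightarrow> symbinom n k = 0"
  by (simp add: symbinom_def)

lemma symbinom_0 [simp]: "symbinom n 0 = 1"
  by (simp add: symbinom_def)

lemma symbinom_gt: "n < k \<Longrightarrow> k \<noteq> 0 \<Longrightarrow> symbinom n k = 0"
  by (cases "k < 0") (auto simp: symbinom_def qbinom_eq_0)

lemma symbinom_self: "0 \<le> n \<Longrightarrow> symbinom n n = 1"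
  by (simp add: symbinom_def)

text \<open>The two Pascal rules for \<open>qbinom\<close> become interchanged by \<open>q \<mapsto> 1/q\<close>, which is the sign \<open>e\<close>.\<close>

lemma symbinom_pascal:
  fixes e :: int
  assumes e: "e = 1 \<or> e = - 1" and n: "0 \<le> n"
  shows "(symbinom (n + 1) k :: 'k::{field,finite} qcoeff)
    = qhalf (- (e * k)) * symbinom n k + qhalf (e * (n + 1 - k)) * symbinom n (k - 1)"
proof -
  consider "k < 0" | "k = 0" | "k > n + 1" | "1 \<le> k" "k \<le> n + 1" by linarith
  then show ?thesis
  proof cases
    case 3
    then show ?thesis using n by (simp add: symbinom_gt)
  next
    case 4
    define N K where "N = nat n" and "K = nat (k - 1)"
    have NK: "n = int N" "k = int K + 1" "K \<le> N" using 4 n by (auto simp: N_def K_def)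
    let ?g = "\<lambda>n k. of_nat (qbinom CARD('k) n k) :: 'k qcoeff"
    have s: "symbinom (n + 1) k = (qhalf (- (k * (n + 1 - k))) * ?g (Suc N) (Suc K) :: 'k qcoeff)"
      "symbinom n k = (qhalf (- (k * (n - k))) * ?g N (Suc K) :: 'k qcoeff)"
      "symbinom n (k - 1) = (qhalf (- ((k - 1) * (n - (k - 1)))) * ?g N K :: 'k qcoeff)"
      using NK by (auto simp: symbinom_def nat_add_distrib simp del: qbinom.simps)
    show ?thesis
      using e
    proof
      assume e: "e = - 1"
      have g: "?g (Suc N) (Suc K) = ?g N K + qhalf (2 * k) * ?g N (Suc K)"
      proof -
        have "2 * int (Suc K) = 2 * k" using NK by simp
        then show ?thesis
          by (simp only: qbinom.simps of_nat_add of_nat_mult of_nat_CARD_power)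
      qed
      have q: "- (k * (n + 1 - k)) = - (n + 1 - k) + - ((k - 1) * (n - (k - 1)))"
        "- (k * (n + 1 - k)) + 2 * k = k + - (k * (n - k))"
        by (simp_all add: algebra_simps)
      have "symbinom (n + 1) k = qhalf (- (k * (n + 1 - k))) * ?g N K + qhalf (- (k * (n + 1 - k)) + 2 * k) * ?g N (Suc K)"
        unfolding s g qhalf_add by (simp only: algebra_simps)
      also have "\<dots> = qhalf (- (n + 1 - k)) * (qhalf (- ((k - 1) * (n - (k - 1)))) * ?g N K) + qhalf k * (qhalf (- (k * (n - k))) * ?g N (Suc K))"
        unfolding q(2) unfolding q(1) unfolding qhalf_add by (simp only: mult.assoc)
      finally show ?thesis
        unfolding e s by (simp add: add.commute)
    next
      assume e: "e = 1"
      have "qbinom CARD('k) (Suc N) (Suc K) = CARD('k) ^ (N - K) * qbinom CARD('k) N K + qbinom CARD('k) N (Suc K)"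
        by (rule qbinom_pascal_alt[OF CARD_field_ge_2 NK(3)])
      moreover have "int (N - K) = n + 1 - k" using NK by simp
      ultimately have g: "?g (Suc N) (Suc K) = qhalf (2 * (n + 1 - k)) * ?g N K + ?g N (Suc K)"
        by (simp only: of_nat_add of_nat_mult of_nat_CARD_power)
      have q: "- (k * (n + 1 - k)) + 2 * (n + 1 - k) = (n + 1 - k) + - ((k - 1) * (n - (k - 1)))"
        "- (k * (n + 1 - k)) = - k + - (k * (n - k))"
        by (simp_all add: algebra_simps)
      have "symbinom (n + 1) k = qhalf (- (k * (n + 1 - k)) + 2 * (n + 1 - k)) * ?g N K + qhalf (- (k * (n + 1 - k))) * ?g N (Suc K)"
        unfolding s g qhalf_add by (simp only: algebra_simps)
      also have "\<dots> = qhalf (n + 1 - k) * (qhalf (- ((k - 1) * (n - (k - 1)))) * ?g N K) + qhalf (- k) * (qhalf (- (k * (n - k))) * ?g N (Suc K))"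
        unfolding q(1) unfolding q(2) unfolding qhalf_add by (simp only: mult.assoc)
      finally show ?thesis
        unfolding e s by (simp add: add.commute)
    qed
  qed (use n in simp_all)
qed

text \<open>The coefficient of the term for \<open>(a, b)\<close> in \<open>x\<^sub>1\<^sub>-\<^sub>N\<close>, i.e. in the character of \<open>V(1-N)\<close> for positive \<open>N\<close>. Allowing
  \<open>N = 0\<close>, where only \<open>(0, 0)\<close> contributes, includes the monomial \<open>x\<^sub>1\<close>.\<close>

definition char_coef :: "int \<Rightarrow> int \<Rightarrow> int \<Rightarrow> 'k::{field,finite} qcoeff" where
  "char_coef N a b = symbinom (N - a) (b - a) * symbinom (b - 1) a"

lemma char_coef_eq_0:
  assumes "1 \<le> N" "\<not> (0 \<le> a \<and> a \<le> N - 1 \<and> 0 \<le> b \<and> b \<le> N)"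
  shows "char_coef N a b = 0"
proof -
  consider "a < 0" | "b < a" | "0 \<le> a" "b = a" "N \<le> a" | "0 \<le> a" "a < b" "N < b" | "a < b" "N \<le> a"
    using assms by linarith
  then show ?thesis
    by cases (use assms(1) in \<open>auto simp: char_coef_def symbinom_gt\<close>)
qed

lemma char_coef_0: "char_coef 0 a b = (if a = 0 \<and> b = 0 then 1 else 0)"
proof -
  consider "a < 0" | "b < a" | "a = 0" "b = 0" | "0 < a" "b = a" | "0 \<le> a" "a < b"
    by linarith
  then show ?thesis
    by cases (auto simp: char_coef_def symbinom_gt)
qed

lemma char_coef_1: "char_coef 1 a b = (if a = 0 \<and> (b = 0 \<or> b = 1) then 1 else 0)"
proof -
  consider "\<not> (0 \<le> a \<and> a \<le> 0 \<and> 0 \<le> b \<and> b \<le> 1)" | "a = 0" "b = 0" | "a = 0" "b = 1"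
    by linarith
  then show ?thesis
  proof cases
    case 1
    then show ?thesis using char_coef_eq_0[of 1 a b] by auto
  qed (auto simp: char_coef_def symbinom_self)
qed

text \<open>In the main range this is a combination of the Pascal rule for the first factor, used twice, and
  the one for the second factor. In the other ranges almost all terms vanish.\<close>

lemma char_coef_rec:
  fixes e :: int
  assumes e: "e = 1 \<or> e = - 1" and N: "1 \<le> N"
  shows "char_coef (N + 1) a b + qhalf (- e) * char_coef (N - 1) (a - 1) (b - 1)
    = qhalf (e * (a - b)) * char_coef N a b + qhalf (e * (N + 1 - a - b)) * char_coef N a (b - 1)
      + qhalf (e * (b - a - 1)) * (char_coef N (a - 1) (b - 1) :: 'k::{field,finite} qcoeff)"
proof -
  consider "b < a" | "b = a" | "a < b" "a < 0" | "0 \<le> a" "a < b" "N < a" | "0 \<le> a" "a < b" "a \<le> N"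
    by linarith
  then show ?thesis
  proof cases
    case 4
    have "symbinom (N - a) (b - 1 - a) * symbinom (b - 2) a = (0 :: 'k qcoeff)"
      using 4 N by (cases "b = a + 1") (auto simp: symbinom_gt)
    then show ?thesis using 4 N
      by (auto simp: char_coef_def symbinom_gt)
  next
    case 5
    define n k p where "n = N - a" and "k = b - a" and "p = b - 2"
    have npk: "0 \<le> n" "1 \<le> k" using 5 by (simp_all add: n_def k_def)
    let ?s = "symbinom :: int \<Rightarrow> int \<Rightarrow> 'k qcoeff"
    have pa: "?s (p + 1) a = qhalf (- (e * a)) * ?s p a + qhalf (e * (p + 1 - a)) * ?s p (a - 1)"
    proof (cases "0 \<le> p")
      case False
      then have "a = 0" "p = - 1" using 5 by (auto simp: p_def)
      then show ?thesis by simp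
    qed (rule symbinom_pascal[OF e])
    note pn = symbinom_pascal[OF e npk(1), of k, where 'k = 'k]
    have eqs: "char_coef (N + 1) a b = ?s (n + 1) k * ?s (p + 1) a"
      "char_coef (N - 1) (a - 1) (b - 1) = ?s n k * ?s p (a - 1)"
      "char_coef N a b = ?s n k * ?s (p + 1) a"
      "char_coef N a (b - 1) = ?s n (k - 1) * ?s p a"
      "char_coef N (a - 1) (b - 1) = ?s (n + 1) k * ?s p (a - 1)"
      by (simp_all add: char_coef_def n_def k_def p_def algebra_simps)
    have h: "qhalf (e * (N + 1 - a - b)) = (qhalf (e * (n + 1 - k)) * qhalf (- (e * a)) :: 'k qcoeff)"
       "qhalf (e * (a - b)) = (qhalf (- (e * k)) :: 'k qcoeff)"
       "qhalf (e * (b - a - 1)) = (qhalf (e * (p + 1 - a)) :: 'k qcoeff)"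
       "qhalf (e * (p + 1 - a)) * qhalf (- (e * k)) = (qhalf (- e) :: 'k qcoeff)"
      unfolding qhalf_add[symmetric]
      by (simp_all add: n_def k_def p_def algebra_simps)
    have "?s (n + 1) k * ?s (p + 1) a + qhalf (- e) * (?s n k * ?s p (a - 1))
      = qhalf (- (e * k)) * (?s n k * ?s (p + 1) a)
        + qhalf (e * (n + 1 - k)) * ?s n (k - 1) * ?s (p + 1) a + qhalf (- e) * (?s n k * ?s p (a - 1))"
      unfolding pn by (simp add: algebra_simps)
    also have "\<dots> = qhalf (- (e * k)) * (?s n k * ?s (p + 1) a)
        + qhalf (e * (n + 1 - k)) * qhalf (- (e * a)) * (?s n (k - 1) * ?s p a)
        + qhalf (e * (p + 1 - a)) * ((qhalf (- (e * k)) * ?s n k + qhalf (e * (n + 1 - k)) * ?s n (k - 1)) * ?s p (a - 1))"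
      unfolding h(4)[symmetric] by (subst (2) pa) (simp add: algebra_simps)
    finally show ?thesis
      unfolding eqs h(1-3) pn[symmetric] .
  qed (auto simp: char_coef_def)
qed

text \<open>The coefficients of \<open>x\<^sub>j\<close> for all \<open>j\<close>, with a shift of \<open>(a, b)\<close> for \<open>j \<ge> 2\<close> that makes the
  exponents uniform in \<open>j\<close>. The two halves are exchanged by \<open>j \<mapsto> 3 - j\<close> since the modules \<open>V(j)\<close>
  and \<open>V(3-j)\<close> are dual to each other: a submodule of one corresponds to its annihilator in the other.\<close>

definition cluster_coef :: "int \<Rightarrow> int \<Rightarrow> int \<Rightarrow> 'k::{field,finite} qcoeff" where
  "cluster_coef j a b = (if j \<le> 1 then char_coef (1 - j) a b else char_coef (j - 2) (- b) (- a))"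

lemma cluster_coef_dual: "(cluster_coef (3 - j) a b :: 'k::{field,finite} qcoeff) = cluster_coef j (- b) (- a)"
  by (auto simp: cluster_coef_def)

text \<open>For \<open>j \<le> 0\<close> this is \<open>char_coef_rec\<close>, and for \<open>j = 1\<close> only few coefficients are not zero. The duality
  \<open>j \<mapsto> 3 - j\<close> gives the rest: it maps the relation for \<open>e\<close> to the one for \<open>- e\<close>, up to a power of \<open>q\<close>.\<close>

lemma cluster_coef_rec:
  fixes e :: int
  assumes e: "e = 1 \<or> e = - 1"
  shows "cluster_coef (j - 1) a b + qhalf (- e) * cluster_coef (j + 1) (a - 1) (b - 1)
    = qhalf (e * (a - b)) * cluster_coef j a b + qhalf (e * (2 - j - a - b)) * cluster_coef j a (b - 1)
      + qhalf (e * (b - a - 1)) * (cluster_coef j (a - 1) (b - 1) :: 'k::{field,finite} qcoeff)"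
proof -
  have low: "cluster_coef (j - 1) a b + qhalf (- e) * cluster_coef (j + 1) (a - 1) (b - 1)
    = qhalf (e * (a - b)) * cluster_coef j a b + qhalf (e * (2 - j - a - b)) * cluster_coef j a (b - 1)
      + qhalf (e * (b - a - 1)) * (cluster_coef j (a - 1) (b - 1) :: 'k::{field,finite} qcoeff)"
    if "j \<le> 1" and e: "e = 1 \<or> e = - 1" for j a b e :: int
  proof (cases "j = 1")
    case True
    then show ?thesis by (auto simp: cluster_coef_def char_coef_0 char_coef_1)
  next
    case False
    then have "j \<le> 0" using that by simp
    then show ?thesis
      using char_coef_rec[OF e, of "1 - j" a b, where 'k = 'k] by (simp add: cluster_coef_def algebra_simps)
  qed
  show ?thesis
  proof (cases "j \<le> 1")
    case True
    then show ?thesis using low e by blast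
  next
    case False
    have e': "- e = 1 \<or> - e = - 1" using e by auto
    have d: "cluster_coef (3 - j - 1) (1 - b) (1 - a) = (cluster_coef (j + 1) (a - 1) (b - 1) :: 'k qcoeff)"
      "cluster_coef (3 - j + 1) (1 - b - 1) (1 - a - 1) = (cluster_coef (j - 1) a b :: 'k qcoeff)"
      "cluster_coef (3 - j) (1 - b) (1 - a) = (cluster_coef j (a - 1) (b - 1) :: 'k qcoeff)"
      "cluster_coef (3 - j) (1 - b) (1 - a - 1) = (cluster_coef j a (b - 1) :: 'k qcoeff)"
      "cluster_coef (3 - j) (1 - b - 1) (1 - a - 1) = (cluster_coef j a b :: 'k qcoeff)"
      using cluster_coef_dual[of "j + 1", where 'k = 'k] cluster_coef_dual[of "j - 1", where 'k = 'k] cluster_coef_dual[of j, where 'k = 'k] by (simp_all add: algebra_simps)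
    have "cluster_coef (j + 1) (a - 1) (b - 1) + qhalf e * cluster_coef (j - 1) a b
      = qhalf (- e * (1 - b - (1 - a))) * cluster_coef j (a - 1) (b - 1) + qhalf (- e * (2 - (3 - j) - (1 - b) - (1 - a))) * cluster_coef j a (b - 1)
      + qhalf (- e * (1 - a - (1 - b) - 1)) * (cluster_coef j a b :: 'k qcoeff)"
      using low[OF _ e', of "3 - j" "1 - b" "1 - a"] False unfolding d by simp
    then have "qhalf (- e) * (cluster_coef (j + 1) (a - 1) (b - 1) + qhalf e * cluster_coef (j - 1) a b)
      = qhalf (- e) * (qhalf (- e * (1 - b - (1 - a))) * cluster_coef j (a - 1) (b - 1) + qhalf (- e * (2 - (3 - j) - (1 - b) - (1 - a))) * cluster_coef j a (b - 1)
      + qhalf (- e * (1 - a - (1 - b) - 1)) * (cluster_coef j a b :: 'k qcoeff))"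
      by simp
    then have "qhalf (- e) * cluster_coef (j + 1) (a - 1) (b - 1) + qhalf (- e + e) * cluster_coef (j - 1) a b
      = qhalf (- e + - e * (1 - b - (1 - a))) * cluster_coef j (a - 1) (b - 1) + qhalf (- e + - e * (2 - (3 - j) - (1 - b) - (1 - a))) * cluster_coef j a (b - 1)
      + qhalf (- e + - e * (1 - a - (1 - b) - 1)) * (cluster_coef j a b :: 'k qcoeff)"
      by (simp only: qhalf_add distrib_left mult.assoc)
    then show ?thesis by (simp add: algebra_simps)
  qed
qed

lemma qt_coeff_qX_mult: "qt_coeff (qX g * f) e = qhalf (Lam g (e - g)) * qt_coeff f (e - g)"
proof -
  have "qt_coeff (qX g * f) e = (\<Sum>a\<in>{g}. (if a = g then 1 else 0) * qt_coeff f (e - a) * qhalf (Lam a (e - a)))"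
    unfolding times_qtorus.rep_eq qX.rep_eq by (rule twisted_mult_superset) auto
  then show ?thesis by (simp add: mult.commute)
qed

lemma qt_coeff_mult_qX: "qt_coeff (f * qX g) e = qhalf (- Lam g (e - g)) * qt_coeff f (e - g)"
proof -
  have "qt_coeff (f * qX g) e = (\<Sum>a | qt_coeff f a \<noteq> 0. qt_coeff f a * (if e - a = g then 1 else 0) * qhalf (Lam a (e - a)))"
    unfolding times_qtorus.rep_eq qX.rep_eq twisted_mult_def ..
  also have "\<dots> = (\<Sum>a | qt_coeff f a \<noteq> 0. if e - g = a then qt_coeff f a * qhalf (Lam a g) else 0)"
    by (intro sum.cong refl) (auto simp: algebra_simps)
  also have "\<dots> = qt_coeff f (e - g) * qhalf (Lam (e - g) g)"
    by (subst sum.delta'[OF finite_support]) auto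
  finally show ?thesis by (metis Lam_skew mult.commute)
qed

text \<open>The term of the character that contributes to a given monomial is determined by the last two exponents.\<close>

lemma qt_coeff_qchar:
  assumes M: "dimvec M = (m1, m2)"
  shows "qt_coeff (qchar M :: 'k::{field,finite} qtorus) (f1, f2, f3, f4) =
    (let a = int m1 - f3; b = int m2 - f4 in
     if 0 \<le> a \<and> a \<le> int m1 \<and> 0 \<le> b \<and> b \<le> int m2
        \<and> f1 = 2 * int m2 - int m1 - 2 * b \<and> f2 = 2 * a - int m2
     then of_nat (card (Gr (nat a, nat b) M)) * qhalf (- euler_form (a, b) (int m1 - a, int m2 - b)) else 0)"
proof -
  define a b where "a = int m1 - f3" and "b = int m2 - f4"
  let ?c = "\<lambda>e1 e2. of_nat (card (Gr (e1, e2) M)) *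
          qhalf (- euler_form (int e1, int e2) (int m1 - int e1, int m2 - int e2)) :: 'k qcoeff"
  let ?P = "f1 = 2 * int m2 - int m1 - 2 * b \<and> f2 = 2 * a - int m2"
  have "qt_coeff (qchar M) (f1, f2, f3, f4) = (\<Sum>x\<in>{0..m1} \<times> {0..m2}.
     if x = (nat a, nat b) then (if 0 \<le> a \<and> 0 \<le> b \<and> ?P then ?c (nat a) (nat b) else 0) else 0)"
    unfolding qchar_def M prod.case qt_coeff_sum
  proof (rule sum.cong[OF refl], clarify)
    fix e1 e2
    let ?X = "(2 * int m2 - int m1 - 2 * int e2, 2 * int e1 - int m2, int m1 - int e1, int m2 - int e2)"
    have "(f1, f2, f3, f4) = ?X \<longleftrightarrow> (e1, e2) = (nat a, nat b) \<and> 0 \<le> a \<and> 0 \<le> b \<and> ?P"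
      by (auto simp: a_def b_def)
    then show "qt_coeff (qscale (?c e1 e2) (qX ?X)) (f1, f2, f3, f4)
       = (if (e1, e2) = (nat a, nat b) then (if 0 \<le> a \<and> 0 \<le> b \<and> ?P then ?c (nat a) (nat b) else 0) else 0)"
      unfolding qscale.rep_eq qX.rep_eq by (auto simp del: euler_form.simps)
  qed
  also have "\<dots> = (if (nat a, nat b) \<in> {0..m1} \<times> {0..m2} then (if 0 \<le> a \<and> 0 \<le> b \<and> ?P then ?c (nat a) (nat b) else 0) else 0)"
    by (subst sum.delta) auto
  also have "\<dots> = (if 0 \<le> a \<and> a \<le> int m1 \<and> 0 \<le> b \<and> b \<le> int m2 \<and> ?P
     then of_nat (card (Gr (nat a, nat b) M)) * qhalf (- euler_form (a, b) (int m1 - a, int m2 - b)) else 0)"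
    by (auto simp: nat_le_iff simp del: euler_form.simps)
  finally show ?thesis by (simp only: a_def b_def Let_def conj_assoc)
qed

text \<open>The exponent \<open>-\<langle>e, m - e\<rangle>/2\<close> in the character is the sum of the two exponents that symmetrize the
  binomials.\<close>

lemma card_Gr_char_coef:
  fixes a b :: int
  assumes "0 \<le> a" "a \<le> int l" "0 \<le> b" "b \<le> int l + 1"
  shows "of_nat (qbinom CARD('k) (l + 1 - nat a) (nat b - nat a) * qbinom CARD('k) (nat b - 1) (nat a))
      * qhalf (- euler_form (a, b) (int l - a, int l + 1 - b)) = (char_coef (int l + 1) a b :: 'k::{field,finite} qcoeff)"
proof (cases "b < a")
  case True
  then have "nat b - 1 < nat a" using assms by linarith
  then show ?thesis using True by (simp add: char_coef_def qbinom_eq_0)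
next
  case False
  have n: "nat (int l + 1 - a) = l + 1 - nat a" "nat (b - a) = nat b - nat a" "nat (b - 1) = nat b - 1"
    using assms False by linarith+
  have "- euler_form (a, b) (int l - a, int l + 1 - b)
    = - ((b - a) * (int l + 1 - a - (b - a))) + - (a * (b - 1 - a))"
    by (simp add: algebra_simps)
  then have q: "qhalf (- euler_form (a, b) (int l - a, int l + 1 - b))
    = (qhalf (- ((b - a) * (int l + 1 - a - (b - a)))) * qhalf (- (a * (b - 1 - a))) :: 'k qcoeff)"
    by (simp only: qhalf_add)
  show ?thesis
    unfolding q char_coef_def symbinom_def n using False assms by (simp add: mult_ac)
qed

lemma card_Gr_char_coef_dual:
  fixes a b :: int
  assumes "0 \<le> a" "a \<le> int l + 1" "0 \<le> b" "b \<le> int l"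
  shows "of_nat (qbinom CARD('k) (nat b + 1) (nat a) * qbinom CARD('k) (l - nat a) (l - nat b))
      * qhalf (- euler_form (a, b) (int l + 1 - a, int l - b)) = (char_coef (int l + 1) (int l - b) (int l + 1 - a) :: 'k::{field,finite} qcoeff)"
proof -
  have "qbinom CARD('k) (nat b + 1) (nat a) * qbinom CARD('k) (l - nat a) (l - nat b)
    = qbinom CARD('k) (l + 1 - nat (int l - b)) (nat (int l + 1 - a) - nat (int l - b)) * qbinom CARD('k) (nat (int l + 1 - a) - 1) (nat (int l - b))"
  proof (cases "a \<le> b + 1")
    case True
    have n: "l + 1 - nat (int l - b) = nat b + 1" "nat (int l + 1 - a) - nat (int l - b) = nat b + 1 - nat a"
      "nat (int l + 1 - a) - 1 = l - nat a" "nat (int l - b) = l - nat b"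
      using assms True by linarith+
    show ?thesis unfolding n(1-3) unfolding n(4)
      using True assms by (subst qbinom_sym[OF CARD_field_ge_2]) auto
  next
    case False
    then have "nat b + 1 < nat a" "nat (int l + 1 - a) - 1 < nat (int l - b)" using assms by linarith+
    then show ?thesis by (simp add: qbinom_eq_0)
  qed
  moreover have "euler_form (a, b) (int l + 1 - a, int l - b)
    = euler_form (int l - b, int l + 1 - a) (int l - (int l - b), int l + 1 - (int l + 1 - a))"
    by (simp add: algebra_simps)
  ultimately show ?thesis
    using card_Gr_char_coef[of "int l - b" l "int l + 1 - a", where 'k = 'k] assms by (simp only: diff_ge_0_iff_ge)
qed

lemma preprojective_coeff:
  fixes V :: "int \<Rightarrow> 'k::{field,finite} krep"
  assumes V: "kronecker_modules V" and j: "j \<le> 0"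
  shows "qt_coeff (cluster_var V j) (f1, f2, f3, f4)
    = (if f1 = j + 2 * f4 \<and> f2 = - j - 1 - 2 * f3 then cluster_coef j (- j - f3) (1 - j - f4) else 0)"
proof -
  define l where "l = nat (- j)"
  have jl: "j = - int l" using j by (simp add: l_def)
  have M: "is_krep (V j)" "preprojective (V j)" "dimvec (V j) = (l, l + 1)"
    using V unfolding jl kronecker_modules_def by blast+
  obtain Z where Z: "sink_reflection\<^sup>*\<^sup>* (V j) Z" "zero_krep Z"
    using M(2) by (rule preprojective_chain)
  note Gr = card_Gr_sink_chain[OF Z M(1,3)]
  define a b where "a = int l - f3" and "b = int l + 1 - f4"
  have "qt_coeff (cluster_var V j) (f1, f2, f3, f4) = qt_coeff (qchar (V j)) (f1, f2, f3, f4)"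
    using j by (simp add: cluster_var_def)
  also have "\<dots> = (if 0 \<le> a \<and> a \<le> int l \<and> 0 \<le> b \<and> b \<le> int l + 1 \<and> f1 = j + 2 * f4 \<and> f2 = - j - 1 - 2 * f3
     then of_nat (card (Gr (nat a, nat b) (V j))) * qhalf (- euler_form (a, b) (int l - a, int l + 1 - b)) else 0)"
    unfolding qt_coeff_qchar[OF M(3)] Let_def
    by (auto simp: a_def b_def jl algebra_simps simp del: euler_form.simps)
  also have "\<dots> = (if f1 = j + 2 * f4 \<and> f2 = - j - 1 - 2 * f3 then char_coef (int l + 1) a b else 0)"
  proof (cases "0 \<le> a \<and> a \<le> int l \<and> 0 \<le> b \<and> b \<le> int l + 1")
    case True
    then have "card (Gr (nat a, nat b) (V j)) = qbinom CARD('k) (l + 1 - nat a) (nat b - nat a) * qbinom CARD('k) (nat b - 1) (nat a)"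
      by (intro Gr) linarith
    then show ?thesis using card_Gr_char_coef[of a l b, where 'k = 'k] True by (simp del: euler_form.simps)
  next
    case False
    then have "char_coef (int l + 1) a b = (0 :: 'k qcoeff)" by (intro char_coef_eq_0) auto
    then show ?thesis using False by auto
  qed
  also have "char_coef (int l + 1) a b = (cluster_coef j (- j - f3) (1 - j - f4) :: 'k qcoeff)"
    using j by (simp add: cluster_coef_def a_def b_def jl add.commute)
  finally show ?thesis .
qed

lemma preinjective_coeff:
  fixes V :: "int \<Rightarrow> 'k::{field,finite} krep"
  assumes V: "kronecker_modules V" and j: "1 \<le> j"
  shows "qt_coeff (cluster_var V j) (f1, f2, f3, f4)
    = (if f1 = 2 - j + 2 * f4 \<and> f2 = j - 1 - 2 * f3 then cluster_coef j (- f3) (- f4) else 0)"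
proof -
  consider "j = 1" | "j = 2" | "3 \<le> j" using j by linarith
  then show ?thesis
  proof cases
    case 1
    then show ?thesis by (auto simp: cluster_var_def qX.rep_eq cluster_coef_def char_coef_0)
  next
    case 2
    then show ?thesis by (auto simp: cluster_var_def qX.rep_eq cluster_coef_def char_coef_0)
  next
    case 3
    define l where "l = nat (j - 3)"
    have jl: "j = int l + 3" using 3 by (simp add: l_def)
    have M: "is_krep (V j)" "preinjective (V j)" "dimvec (V j) = (l + 1, l)"
      using V unfolding jl kronecker_modules_def by blast+
    obtain Z where Z: "source_reflection\<^sup>*\<^sup>* (V j) Z" "zero_krep Z"
      using M(2) by (rule preinjective_chain)
    note Gr = card_Gr_source_chain[OF Z M(1,3)]
    define a b where "a = int l + 1 - f3" and "b = int l - f4"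
    have "qt_coeff (cluster_var V j) (f1, f2, f3, f4) = qt_coeff (qchar (V j)) (f1, f2, f3, f4)"
      using 3 by (simp add: cluster_var_def)
    also have "\<dots> = (if 0 \<le> a \<and> a \<le> int l + 1 \<and> 0 \<le> b \<and> b \<le> int l \<and> f1 = 2 - j + 2 * f4 \<and> f2 = j - 1 - 2 * f3
       then of_nat (card (Gr (nat a, nat b) (V j))) * qhalf (- euler_form (a, b) (int l + 1 - a, int l - b)) else 0)"
      unfolding qt_coeff_qchar[OF M(3)] Let_def
      by (auto simp: a_def b_def jl algebra_simps simp del: euler_form.simps)
    also have "\<dots> = (if f1 = 2 - j + 2 * f4 \<and> f2 = j - 1 - 2 * f3 then char_coef (int l + 1) (int l - b) (int l + 1 - a) else 0)"
    proof (cases "0 \<le> a \<and> a \<le> int l + 1 \<and> 0 \<le> b \<and> b \<le> int l")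
      case True
      then have "card (Gr (nat a, nat b) (V j)) = qbinom CARD('k) (nat b + 1) (nat a) * qbinom CARD('k) (l - nat a) (l - nat b)"
        by (intro Gr) linarith+
      then show ?thesis using card_Gr_char_coef_dual[of a l b, where 'k = 'k] True by (simp del: euler_form.simps)
    next
      case False
      then have "char_coef (int l + 1) (int l - b) (int l + 1 - a) = (0 :: 'k qcoeff)" by (intro char_coef_eq_0) auto
      then show ?thesis using False by auto
    qed
    also have "char_coef (int l + 1) (int l - b) (int l + 1 - a) = (cluster_coef j (- f3) (- f4) :: 'k qcoeff)"
    proof -
      have "j - 2 = int l + 1" by (simp add: jl)
      then show ?thesis using 3 by (simp only: cluster_coef_def a_def b_def) simp
    qed
    finally show ?thesis .
  qed
qed

section \<open>Three-term relations\<close>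

text \<open>For positive \<open>j\<close> the monomial in the coefficients moves the exponents of \<open>x\<^sub>j\<close> to those obtained by continuing the
  pattern from \<open>j \<le> 0\<close>, and the power of \<open>q\<close> cancels the one from the multiplication. Dually for
  \<open>right_var\<close>, where the pattern of positive \<open>j\<close> is continued.\<close>

definition left_var :: "(int \<Rightarrow> 'k::{field,finite} krep) \<Rightarrow> int \<Rightarrow> 'k qtorus" where
  "left_var V j = (if j \<le> 0 then cluster_var V j
     else qscale (qhalf 1) (qX (0, 0, - j, 1 - j) * cluster_var V j))"

definition right_var :: "(int \<Rightarrow> 'k::{field,finite} krep) \<Rightarrow> int \<Rightarrow> 'k qtorus" where
  "right_var V j = (if 1 \<le> j then cluster_var V j
     else qscale (qhalf 1) (cluster_var V j * qX (0, 0, j, j - 1)))"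

lemma left_var_coeff:
  assumes V: "kronecker_modules V"
  shows "qt_coeff (left_var V j) (f1, f2, f3, f4)
    = (if f1 = j + 2 * f4 \<and> f2 = - j - 1 - 2 * f3 then cluster_coef j (- j - f3) (1 - j - f4) else 0)"
proof (cases "j \<le> 0")
  case True
  then show ?thesis using preprojective_coeff[OF V True] by (simp add: left_var_def)
next
  case False
  have q: "qhalf 1 * qhalf (- 1) = (1 :: 'a qcoeff)" by (simp flip: qhalf_add)
  have L: "Lam (0, 0, - j, 1 - j) (f1, f2, f3 + j, f4 + (j - 1)) = - 1"
    if "f1 = j + 2 * f4" "f2 = - j - 1 - 2 * f3"
    unfolding that by (simp add: algebra_simps)
  have d: "(f1, f2, f3, f4) - (0, 0, - j, 1 - j) = (f1, f2, f3 + j, f4 + (j - 1))" by simp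
  have args: "- (f3 + j) = - j - f3" "- (f4 + (j - 1)) = 1 - j - f4"
    "2 - j + 2 * (f4 + (j - 1)) = j + 2 * f4" "j - 1 - 2 * (f3 + j) = - j - 1 - 2 * f3"
    by simp_all
  have "1 \<le> j" using False by simp
  note c = preinjective_coeff[OF V this, of f1 f2 "f3 + j" "f4 + (j - 1)", unfolded args]
  have "qt_coeff (left_var V j) (f1, f2, f3, f4)
    = qhalf 1 * (qhalf (Lam (0, 0, - j, 1 - j) (f1, f2, f3 + j, f4 + (j - 1))) * qt_coeff (cluster_var V j) (f1, f2, f3 + j, f4 + (j - 1)))"
    using False by (simp only: left_var_def if_False qscale.rep_eq qt_coeff_qX_mult d)
  then show ?thesis
    unfolding c using L q by (auto simp del: Lam.simps simp flip: mult.assoc)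
qed

lemma right_var_coeff:
  assumes V: "kronecker_modules V"
  shows "qt_coeff (right_var V j) (f1, f2, f3, f4)
    = (if f1 = 2 - j + 2 * f4 \<and> f2 = j - 1 - 2 * f3 then cluster_coef j (- f3) (- f4) else 0)"
proof (cases "1 \<le> j")
  case True
  then show ?thesis using preinjective_coeff[OF V True] by (simp add: right_var_def)
next
  case False
  have q: "qhalf 1 * qhalf (- 1) = (1 :: 'a qcoeff)" by (simp flip: qhalf_add)
  have L: "Lam (0, 0, j, j - 1) (f1, f2, f3 - j, f4 - (j - 1)) = 1"
    if "f1 = 2 - j + 2 * f4" "f2 = j - 1 - 2 * f3"
    unfolding that by (simp add: algebra_simps)
  have d: "(f1, f2, f3, f4) - (0, 0, j, j - 1) = (f1, f2, f3 - j, f4 - (j - 1))" by simp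
  have args: "- j - (f3 - j) = - f3" "1 - j - (f4 - (j - 1)) = - f4"
    "j + 2 * (f4 - (j - 1)) = 2 - j + 2 * f4" "- j - 1 - 2 * (f3 - j) = j - 1 - 2 * f3"
    by simp_all
  have "j \<le> 0" using False by simp
  note c = preprojective_coeff[OF V this, of f1 f2 "f3 - j" "f4 - (j - 1)", unfolded args]
  have "qt_coeff (right_var V j) (f1, f2, f3, f4)
    = qhalf 1 * (qhalf (- Lam (0, 0, j, j - 1) (f1, f2, f3 - j, f4 - (j - 1))) * qt_coeff (cluster_var V j) (f1, f2, f3 - j, f4 - (j - 1)))"
    using False by (simp only: right_var_def if_False qscale.rep_eq qt_coeff_mult_qX d)
  then show ?thesis
    unfolding c using L q by (auto simp del: Lam.simps simp flip: mult.assoc)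
qed

text \<open>All five terms are supported on the same set of exponents, parametrized by \<open>(a, b)\<close>; comparing
  coefficients gives \<open>cluster_coef_rec\<close> with \<open>e = 1\<close>.\<close>

lemma X_delta_mult_left_var:
  fixes V :: "int \<Rightarrow> 'k::{field,finite} krep"
  assumes V: "kronecker_modules V"
  shows "X_delta * left_var V j = left_var V (j - 1) + qX (0, 0, 1, 1) * left_var V (j + 1)"
proof (rule qtorus_eqI)
  fix f :: int4
  obtain f1 f2 f3 f4 where f: "f = (f1, f2, f3, f4)" by (cases f)
  let ?c = "\<lambda>x. qt_coeff (x :: 'k qtorus) (f1, f2, f3, f4)"
  let ?P = "f1 = j - 1 + 2 * f4 \<and> f2 = - j - 2 * f3"
  define a b where "a = 1 - j - f3" and "b = 2 - j - f4"
  have f34: "f3 = 1 - j - a" "f4 = 2 - j - b" by (simp_all add: a_def b_def)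
  have c: "?c (qX (1, -1, 1, 1) * left_var V j) = (if ?P then qhalf (a - b) * cluster_coef j a b else 0)"
    "?c (qX (-1, -1, 1, 0) * left_var V j) = (if ?P then qhalf (2 - j - a - b) * cluster_coef j a (b - 1) else 0)"
    "?c (qX (-1, 1, 0, 0) * left_var V j) = (if ?P then qhalf (b - a - 1) * cluster_coef j (a - 1) (b - 1) else 0)"
    "?c (qX (0, 0, 1, 1) * left_var V (j + 1)) = (if ?P then qhalf (- 1) * cluster_coef (j + 1) (a - 1) (b - 1) else 0)"
    "?c (left_var V (j - 1)) = (if ?P then cluster_coef (j - 1) a b else 0)"
    by (auto simp: qt_coeff_qX_mult left_var_coeff[OF V] f34
      intro!: arg_cong2[where f = "(*)"] arg_cong[where f = qhalf])
  have "?c (X_delta * left_var V j) = ?c (left_var V (j - 1) + qX (0, 0, 1, 1) * left_var V (j + 1))"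
    using c cluster_coef_rec[of 1 j a b, where 'k = 'k]
    by (simp add: X_delta_def distrib_right plus_qtorus.rep_eq)
  then show "qt_coeff (X_delta * left_var V j) f = qt_coeff (left_var V (j - 1) + qX (0, 0, 1, 1) * left_var V (j + 1)) f"
    by (simp only: f)
qed

text \<open>Multiplication from the other side inverts the powers of \<open>q\<close>, so this is \<open>cluster_coef_rec\<close> with
  \<open>e = - 1\<close>, multiplied by \<open>q\<^sup>-\<^sup>1\<^sup>/\<^sup>2\<close>.\<close>

lemma right_var_mult_X_delta:
  fixes V :: "int \<Rightarrow> 'k::{field,finite} krep"
  assumes V: "kronecker_modules V"
  shows "right_var V j * X_delta = right_var V (j + 1) + right_var V (j - 1) * qX (0, 0, 1, 1)"
proof (rule qtorus_eqI)
  fix f :: int4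
  obtain f1 f2 f3 f4 where f: "f = (f1, f2, f3, f4)" by (cases f)
  let ?c = "\<lambda>x. qt_coeff (x :: 'k qtorus) (f1, f2, f3, f4)"
  let ?P = "f1 = 1 - j + 2 * f4 \<and> f2 = j - 2 * f3"
  define a b where "a = 1 - f3" and "b = 1 - f4"
  have f34: "f3 = 1 - a" "f4 = 1 - b" by (simp_all add: a_def b_def)
  have c: "?c (right_var V j * qX (1, -1, 1, 1)) = (if ?P then qhalf (b - a - 1) * cluster_coef j a b else 0)"
    "?c (right_var V j * qX (-1, -1, 1, 0)) = (if ?P then qhalf (a + b + j - 3) * cluster_coef j a (b - 1) else 0)"
    "?c (right_var V j * qX (-1, 1, 0, 0)) = (if ?P then qhalf (a - b) * cluster_coef j (a - 1) (b - 1) else 0)"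
    "?c (right_var V (j - 1) * qX (0, 0, 1, 1)) = (if ?P then qhalf (- 1) * cluster_coef (j - 1) a b else 0)"
    "?c (right_var V (j + 1)) = (if ?P then cluster_coef (j + 1) (a - 1) (b - 1) else 0)"
    by (auto simp: qt_coeff_mult_qX right_var_coeff[OF V] f34
      intro!: arg_cong2[where f = "(*)"] arg_cong[where f = qhalf])
  have "qhalf (- 1) * (cluster_coef (j - 1) a b + qhalf 1 * cluster_coef (j + 1) (a - 1) (b - 1))
    = qhalf (- 1) * (qhalf (b - a) * cluster_coef j a b + qhalf (a + b + j - 2) * cluster_coef j a (b - 1)
      + qhalf (a - b + 1) * (cluster_coef j (a - 1) (b - 1) :: 'k qcoeff))"
    using cluster_coef_rec[of "- 1" j a b, where 'k = 'k] by (simp add: algebra_simps)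
  then have "qhalf (- 1) * cluster_coef (j - 1) a b + qhalf (- 1 + 1) * cluster_coef (j + 1) (a - 1) (b - 1)
    = qhalf (- 1 + (b - a)) * cluster_coef j a b + qhalf (- 1 + (a + b + j - 2)) * cluster_coef j a (b - 1)
      + qhalf (- 1 + (a - b + 1)) * (cluster_coef j (a - 1) (b - 1) :: 'k qcoeff)"
    by (simp only: qhalf_add distrib_left mult.assoc)
  then have "qhalf (- 1) * cluster_coef (j - 1) a b + cluster_coef (j + 1) (a - 1) (b - 1)
    = qhalf (b - a - 1) * cluster_coef j a b + qhalf (a + b + j - 3) * cluster_coef j a (b - 1)
      + qhalf (a - b) * (cluster_coef j (a - 1) (b - 1) :: 'k qcoeff)"
    by (simp add: algebra_simps)
  then have "?c (right_var V j * X_delta) = ?c (right_var V (j + 1) + right_var V (j - 1) * qX (0, 0, 1, 1))"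
    using c by (simp add: X_delta_def distrib_left plus_qtorus.rep_eq add.commute)
  then show "qt_coeff (right_var V j * X_delta) f = qt_coeff (right_var V (j + 1) + right_var V (j - 1) * qX (0, 0, 1, 1)) f"
    by (simp only: f)
qed

section \<open>Multiplication by the Chebyshev elements\<close>

lemma qX_Y_commutes_X_delta: "qX (0, 0, i, i) * X_delta = X_delta * qX (0, 0, i, i)"
  by (simp add: X_delta_def distrib_left distrib_right qX_mult add.commute)

lemma commute_mult:
  fixes a b c :: "'a::semigroup_mult"
  assumes "a * b = b * a" "a * c = c * a"
  shows "a * (b * c) = b * c * a"
proof -
  have "a * (b * c) = b * (a * c)"
    unfolding mult.assoc[symmetric] assms(1) ..
  then show ?thesis by (simp only: assms(2) mult.assoc)
qed

lemma qX_Y_commutes_cheb: "qX (0, 0, i, i) * cheb m = cheb m * (qX (0, 0, i, i) :: 'k::{field,finite} qtorus)"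
proof (induction m rule: cheb.induct)
  case 3
  have "qX (0, 0, i, i) * qX (0, 0, 1, 1) = qX (0, 0, 1, 1) * (qX (0, 0, i, i) :: 'k qtorus)"
    by (simp add: qX_mult add.commute)
  then have "qX (0, 0, i, i) * (2 * qX (0, 0, 1, 1)) = 2 * qX (0, 0, 1, 1) * (qX (0, 0, i, i) :: 'k qtorus)"
    by (simp only: mult_2 distrib_left distrib_right)
  moreover have "qX (0, 0, i, i) * (X_delta * X_delta) = X_delta * X_delta * (qX (0, 0, i, i) :: 'k qtorus)"
    by (intro commute_mult qX_Y_commutes_X_delta)
  ultimately show ?case
    by (simp only: cheb.simps right_diff_distrib left_diff_distrib)
next
  case (4 n)
  have "qX (0, 0, i, i) * qX (0, 0, 1, 1) = qX (0, 0, 1, 1) * (qX (0, 0, i, i) :: 'k qtorus)"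
    by (simp add: qX_mult add.commute)
  then have "qX (0, 0, i, i) * (qX (0, 0, 1, 1) * cheb (Suc n)) = qX (0, 0, 1, 1) * cheb (Suc n) * (qX (0, 0, i, i) :: 'k qtorus)"
    by (intro commute_mult 4(2))
  moreover have "qX (0, 0, i, i) * (cheb (Suc (Suc n)) * X_delta) = cheb (Suc (Suc n)) * X_delta * (qX (0, 0, i, i) :: 'k qtorus)"
    by (intro commute_mult qX_Y_commutes_X_delta 4(1))
  ultimately show ?case
    by (simp add: right_diff_distrib left_diff_distrib)
qed (simp_all add: qX_Y_commutes_X_delta)

lemma qX_Y_mult: "qX (0, 0, i, i) * qX (0, 0, j, j) = qX (0, 0, i + j, i + j)"
  by (simp add: qX_mult, rule qtorus_eqI, simp add: qscale.rep_eq)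

text \<open>In the induction step, the terms with index \<open>j \<plusminus> (m - 1)\<close> that arise from the three-term relation are
  exactly those removed by the Chebyshev recursion. For \<open>m = 2\<close> the term \<open>Y * L j\<close> arises twice,
  whence the factor 2 in the definition of \<open>F\<^sub>2\<close>.\<close>

lemma cheb_mult_left_var:
  fixes V :: "int \<Rightarrow> 'k::{field,finite} krep"
  assumes V: "kronecker_modules V" and "1 \<le> m"
  shows "cheb m * left_var V j = left_var V (j - int m) + qX (0, 0, int m, int m) * left_var V (j + int m)"
  using assms(2)
proof (induction m arbitrary: j rule: cheb.induct)
  case 2
  then show ?case using X_delta_mult_left_var[OF V] by simp
next
  case 3
  let ?Y = "qX (0, 0, 1, 1) :: 'k qtorus"
  have "X_delta * X_delta * left_var V j = X_delta * left_var V (j - 1) + ?Y * (X_delta * left_var V (j + 1))"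
    unfolding mult.assoc X_delta_mult_left_var[OF V, of j] distrib_left
    by (simp add: qX_Y_commutes_X_delta flip: mult.assoc)
  also have "\<dots> = left_var V (j - 2) + 2 * ?Y * left_var V j + qX (0, 0, 2, 2) * left_var V (j + 2)"
    unfolding X_delta_mult_left_var[OF V] using qX_Y_mult[of 1 1, where 'a = 'k]
    by (simp add: distrib_left distrib_right mult_2 add.commute flip: mult.assoc)
  finally show ?case by (simp add: left_diff_distrib)
next
  case (4 n)
  let ?Y = "qX (0, 0, 1, 1) :: 'k qtorus" and ?m = "int (Suc (Suc n))"
  let ?Ym = "qX (0, 0, ?m, ?m) :: 'k qtorus"
  have Y: "?Ym * ?Y = qX (0, 0, ?m + 1, ?m + 1)" "?Y * qX (0, 0, ?m - 1, ?m - 1) = ?Ym" "?Ym * ?Y = ?Y * ?Ym"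
    using qX_Y_mult[of ?m 1, where 'a = 'k] qX_Y_mult[of 1 "?m - 1", where 'a = 'k] qX_Y_mult[of 1 ?m, where 'a = 'k]
    by (simp_all add: add.commute)
  have "cheb (Suc (Suc n)) * X_delta * left_var V j
    = cheb (Suc (Suc n)) * left_var V (j - 1) + ?Y * (cheb (Suc (Suc n)) * left_var V (j + 1))"
    unfolding mult.assoc X_delta_mult_left_var[OF V, of j] distrib_left
    by (simp add: qX_Y_commutes_cheb flip: mult.assoc)
  also have "\<dots> = left_var V (j - (?m + 1)) + ?Ym * left_var V (j + (?m - 1))
     + ?Y * (left_var V (j - (?m - 1)) + ?Ym * left_var V (j + (?m + 1)))"
    using "4.IH"(1)[of "j - 1"] "4.IH"(1)[of "j + 1"] by (simp add: algebra_simps)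
  also have "\<dots> = left_var V (j - (?m + 1)) + qX (0, 0, ?m + 1, ?m + 1) * left_var V (j + (?m + 1))
     + ?Y * (left_var V (j - (?m - 1)) + qX (0, 0, ?m - 1, ?m - 1) * left_var V (j + (?m - 1)))"
    unfolding distrib_left mult.assoc[symmetric] Y(2) Y(3)[symmetric] Y(1) by (simp add: add_ac)
  also have "left_var V (j - (?m - 1)) + qX (0, 0, ?m - 1, ?m - 1) * left_var V (j + (?m - 1)) = cheb (Suc n) * left_var V j"
    using "4.IH"(2)[of j] by simp
  finally show ?case
    by (simp add: left_diff_distrib mult.assoc)
qed simp

lemma right_var_mult_cheb:
  fixes V :: "int \<Rightarrow> 'k::{field,finite} krep"
  assumes V: "kronecker_modules V" and "1 \<le> m"
  shows "right_var V j * cheb m = right_var V (j + int m) + right_var V (j - int m) * qX (0, 0, int m, int m)"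
  using assms(2)
proof (induction m rule: cheb.induct)
  case 2
  then show ?case using right_var_mult_X_delta[OF V] by simp
next
  case 3
  let ?Y = "qX (0, 0, 1, 1) :: 'k qtorus"
  have "right_var V j * (X_delta * X_delta) = right_var V (j + 1) * X_delta + right_var V (j - 1) * X_delta * ?Y"
    unfolding mult.assoc[symmetric] right_var_mult_X_delta[OF V, of j] distrib_right
    by (simp add: qX_Y_commutes_X_delta mult.assoc)
  also have "\<dots> = right_var V (j + 2) + right_var V j * (2 * ?Y) + right_var V (j - 2) * qX (0, 0, 2, 2)"
    unfolding right_var_mult_X_delta[OF V] using qX_Y_mult[of 1 1, where 'a = 'k]
    by (simp add: distrib_left distrib_right mult_2 mult.assoc add.commute)
  finally show ?case by (simp add: right_diff_distrib)
next
  case (4 n)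
  let ?Y = "qX (0, 0, 1, 1) :: 'k qtorus" and ?m = "int (Suc (Suc n))"
  let ?Ym = "qX (0, 0, ?m, ?m) :: 'k qtorus"
  have Y: "?Y * ?Ym = qX (0, 0, ?m + 1, ?m + 1)" "qX (0, 0, ?m - 1, ?m - 1) * ?Y = ?Ym"
    using qX_Y_mult[of "?m - 1" 1, where 'a = 'k] qX_Y_mult[of 1 ?m, where 'a = 'k]
    by (simp_all add: add.commute)
  have "right_var V j * (cheb (Suc (Suc n)) * X_delta)
    = right_var V (j + ?m) * X_delta + right_var V (j - ?m) * X_delta * ?Ym"
    unfolding mult.assoc[symmetric] using "4.IH"(1)
    by (simp add: distrib_right mult.assoc qX_Y_commutes_X_delta)
  also have "\<dots> = right_var V (j + (?m + 1)) + right_var V (j + (?m - 1)) * ?Y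
     + (right_var V (j - (?m - 1)) + right_var V (j - (?m + 1)) * ?Y) * ?Ym"
    unfolding right_var_mult_X_delta[OF V] by (simp add: algebra_simps)
  also have "\<dots> = right_var V (j + (?m + 1)) + right_var V (j - (?m + 1)) * qX (0, 0, ?m + 1, ?m + 1)
     + (right_var V (j + (?m - 1)) + right_var V (j - (?m - 1)) * qX (0, 0, ?m - 1, ?m - 1)) * ?Y"
    unfolding distrib_right mult.assoc Y by (simp add: add_ac)
  also have "right_var V (j + (?m - 1)) + right_var V (j - (?m - 1)) * qX (0, 0, ?m - 1, ?m - 1) = right_var V j * cheb (Suc n)"
    using "4.IH"(2) by simp
  finally show ?case
    by (simp add: right_diff_distrib mult.assoc qX_Y_commutes_cheb)
qed simp

lemma qscale_qscale: "qscale c (qscale d f) = qscale (c * d) f"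
  by (rule qtorus_eqI) (simp add: qscale.rep_eq mult.assoc)

theorem theorem3p12:
  fixes V :: "int \<Rightarrow> 'k::{field,finite} krep" and m n :: nat
  assumes "kronecker_modules V"
  shows
   "(1 \<le> m \<and> m \<le> n \<longrightarrow>
       cheb m * cluster_var V (- int n) =
         cluster_var V (- (int n + int m)) +
         qX (0, 0, int m, int m) * cluster_var V (- (int n - int m))) \<and>
    (n + 1 \<le> m \<longrightarrow>
       cheb m * cluster_var V (- int n) =
         cluster_var V (- (int n + int m)) +
         qscale (qhalf (- (2 * int m - 1)))
           (qX (0, 0, int n, int n + 1) * cluster_var V (int m - int n))) \<and>
    (1 \<le> m \<and> m < n \<longrightarrow>
       cluster_var V (int n) * cheb m =
         cluster_var V (int n + int m) +
         cluster_var V (int n - int m) * qX (0, 0, int m, int m)) \<and>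
    (1 \<le> n \<and> n \<le> m \<longrightarrow>
       cluster_var V (int n) * cheb m =
         cluster_var V (int n + int m) +
         qscale (qhalf (- (2 * int m - 1)))
           (cluster_var V (- (int m - int n)) * qX (0, 0, int n, int n - 1)))"
proof (intro conjI impI; (elim conjE)?)
  assume m: "1 \<le> m" "m \<le> n"
  show "cheb m * cluster_var V (- int n) = cluster_var V (- (int n + int m)) +
         qX (0, 0, int m, int m) * cluster_var V (- (int n - int m))"
    using cheb_mult_left_var[OF assms m(1), of "- int n"] m by (simp add: left_var_def)
next
  assume m: "n + 1 \<le> m"
  define j where "j = int m - int n"
  have "qX (0, 0, int m, int m) * left_var V j
    = qscale (qhalf (1 + Lam (0, 0, int m, int m) (0, 0, - j, 1 - j))) (qX (0, 0, int n, int n + 1) * cluster_var V j)"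
    using m by (simp add: left_var_def j_def qscale_mult_left qscale_mult_right qX_mult qscale_qscale qhalf_add add.commute
        del: Lam.simps flip: mult.assoc)
  also have "1 + Lam (0, 0, int m, int m) (0, 0, - j, 1 - j) = - (2 * int m - 1)"
    by (simp add: algebra_simps)
  finally show "cheb m * cluster_var V (- int n) = cluster_var V (- (int n + int m)) +
         qscale (qhalf (- (2 * int m - 1))) (qX (0, 0, int n, int n + 1) * cluster_var V (int m - int n))"
    using cheb_mult_left_var[OF assms, of m "- int n"] m
    by (simp add: j_def left_var_def[of V "- int n"] left_var_def[of V "- int n - int m"])
next
  assume m: "1 \<le> m" "m < n"
  show "cluster_var V (int n) * cheb m = cluster_var V (int n + int m) +
         cluster_var V (int n - int m) * qX (0, 0, int m, int m)"
    using right_var_mult_cheb[OF assms m(1), of "int n"] m by (simp add: right_var_def)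
next
  assume n: "1 \<le> n" "n \<le> m"
  define j where "j = int n - int m"
  have "right_var V j * qX (0, 0, int m, int m)
    = qscale (qhalf (1 + Lam (0, 0, j, j - 1) (0, 0, int m, int m))) (cluster_var V j * qX (0, 0, int n, int n - 1))"
    using n by (simp add: right_var_def j_def qscale_mult_left qscale_mult_right qX_mult qscale_qscale qhalf_add mult.assoc
        del: Lam.simps)
  also have "1 + Lam (0, 0, j, j - 1) (0, 0, int m, int m) = - (2 * int m - 1)"
    by (simp add: algebra_simps)
  finally show "cluster_var V (int n) * cheb m = cluster_var V (int n + int m) +
         qscale (qhalf (- (2 * int m - 1))) (cluster_var V (- (int m - int n)) * qX (0, 0, int n, int n - 1))"
    using right_var_mult_cheb[OF assms, of m "int n"] n
    by (simp add: j_def right_var_def[of V "int n"] right_var_def[of V "int n + int m"])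
qed

end
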